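(* Let $p$ and $q$ be prime numbers, not necessarily distinct. The indecomposable cycle sets of order $pq$ with abelian permutation group are, up to isomorphism, the following. Case $p\ne q$: (a) $(\mathbb{Z}/pq\mathbb{Z},\cdot)$ with $i\cdot j=j+1$ for all $i,j\in\mathbb{Z}/pq\mathbb{Z}$; in this case the permutation group is isomorphic to $(\mathbb{Z}/pq\mathbb{Z},+)$. Case $p=q$: (a) $(\mathbb{Z}/p^2\mathbb{Z},\cdot)$ with $i\cdot j=j+1$ for all $i,j\in\mathbb{Z}/p^2\mathbb{Z}$; in this case the permutation group is isomorphic to $(\mathbb{Z}/p^2\mathbb{Z},+)$. (b) $(\mathbb{Z}/p^2\mathbb{Z},\cdot_f)$ with $i\cdot_f j=j+1+pf(i)$ for all $i,j\in\mathbb{Z}/p^2\mathbb{Z}$, where $f:\mathbb{Z}/p\mathbb{Z}\to\{0,\dots,p-1\}$ is a function of the form $f(l)=\overline{lt}$ for some $t\in\mathbb{Z}/p\mathbb{Z}$, $t\neq0$; in this case the permutation group is isomorphic to $(\mathbb{Z}/p^2\mathbb{Z},+)$. Moreover, there are $p-1$ non-isomorphic cycle sets of this type. (c) $(\mathbb{Z}/p\mathbb{Z}\times\mathbb{Z}/p\mathbb{Z},\cdot)$ with $(i,s)\cdot(j,t)=(j+1,t+i)$ for all $i,j,s,t\in\mathbb{Z}/p\mathbb{Z}$; in this case the permutation group is isomorphic to $(\mathbb{Z}/p\mathbb{Z}\times\mathbb{Z}/p\mathbb{Z},+)$.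
   Context: A cycle set is a non-empty set $X$ with a binary operation $\cdot$ such that every left multiplication $\sigma_x:X\to X,\ y\mapsto x\cdot y$ is bijective and $(x\cdot y)\cdot(x\cdot z)=(y\cdot x)\cdot(y\cdot z)$ for all $x,y,z\in X$. The permutation group $\mathcal{G}(X)$ is the subgroup of $Sym(X)$ generated by $\{\sigma_x\mid x\in X\}$. $X$ is indecomposable if there is no partition $\{Y,Z\}$ of $X$ into non-empty subsets with $\sigma_x(Y)\subseteq Y$ and $\sigma_x(Z)\subseteq Z$ for all $x\in X$ (equivalently, $\mathcal{G}(X)$ is transitive on $X$). For $u\in\mathbb{Z}/p\mathbb{Z}$, $\overline{u}$ denotes its representative in $\{0,\dots,p-1\}$; for $i\in\mathbb{Z}/p^2\mathbb{Z}$, $f(i)$ means the value of $f$ at the class of $i$ modulo $p$. *)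

theory Defs
  imports "HOL-Algebra.Bij" "HOL-Algebra.Elementary_Groups" "HOL-Computational_Algebra.Primes"
begin

section \<open>Cycle sets\<close>

text \<open>
  A cycle set is given by its carrier \<open>S\<close> and a binary operation of which only the values on \<open>S\<close>
  matter. Closure of \<open>S\<close> under the operation is part of \<^const>\<open>bij_betw\<close>.
\<close>

locale cycle_set =
  fixes S :: "'a set" and opr :: "'a \<Rightarrow> 'a \<Rightarrow> 'a"  (infixl \<open>\<cdot>\<close> 70)
  assumes nonempty: "S \<noteq> {}"
    and bij_left_mult: "\<And>x. x \<in> S \<Longrightarrow> bij_betw (\<lambda>y. x \<cdot> y) S S"
    and cycle_law: "\<And>x y z. x \<in> S \<Longrightarrow> y \<in> S \<Longrightarrow> z \<in> S \<Longrightarrow>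
          (x \<cdot> y) \<cdot> (x \<cdot> z) = (y \<cdot> x) \<cdot> (y \<cdot> z)"

text \<open>
  Left multiplications are restricted to \<open>S\<close> because the elements of \<^const>\<open>BijGroup\<close> are
  extensional functions.
\<close>

definition left_mult :: "'a set \<Rightarrow> ('a \<Rightarrow> 'a \<Rightarrow> 'a) \<Rightarrow> 'a \<Rightarrow> 'a \<Rightarrow> 'a" where
  "left_mult S opr x = (\<lambda>y\<in>S. opr x y)"

definition permutation_group :: "'a set \<Rightarrow> ('a \<Rightarrow> 'a \<Rightarrow> 'a) \<Rightarrow> ('a \<Rightarrow> 'a) monoid" where
  "permutation_group S opr = subgroup_generated (BijGroup S) (left_mult S opr ` S)"

definition indecomposable :: "'a set \<Rightarrow> ('a \<Rightarrow> 'a \<Rightarrow> 'a) \<Rightarrow> bool" where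
  "indecomposable S opr \<longleftrightarrow>
     \<not> (\<exists>Y Z. Y \<noteq> {} \<and> Z \<noteq> {} \<and> Y \<inter> Z = {} \<and> Y \<union> Z = S \<and>
          (\<forall>x\<in>S. left_mult S opr x ` Y \<subseteq> Y \<and> left_mult S opr x ` Z \<subseteq> Z))"

definition cycle_set_isomorphic ::
  "'a set \<Rightarrow> ('a \<Rightarrow> 'a \<Rightarrow> 'a) \<Rightarrow> 'b set \<Rightarrow> ('b \<Rightarrow> 'b \<Rightarrow> 'b) \<Rightarrow> bool" where
  "cycle_set_isomorphic S opr Y opr' \<longleftrightarrow>
     (\<exists>\<phi>. bij_betw \<phi> S Y \<and> (\<forall>x\<in>S. \<forall>y\<in>S. \<phi> (opr x y) = opr' (\<phi> x) (\<phi> y)))"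

definition indecomposable_abelian :: "nat \<Rightarrow> 'a set \<Rightarrow> ('a \<Rightarrow> 'a \<Rightarrow> 'a) \<Rightarrow> bool" where
  "indecomposable_abelian n S opr \<longleftrightarrow>
     cycle_set S opr \<and> card S = n \<and> indecomposable S opr \<and>
     comm_group (permutation_group S opr)"


section \<open>The cycle sets of the classification\<close>

text \<open>
  Residue classes modulo \<open>n\<close> are represented by the integers in \<open>{0..<n}\<close>, which for \<open>n > 0\<close> is the
  carrier of \<^const>\<open>integer_mod_group\<close>.
\<close>

abbreviation Zmod :: "nat \<Rightarrow> int set" where
  "Zmod n \<equiv> {0..<int n}"

definition shift_op :: "nat \<Rightarrow> int \<Rightarrow> int \<Rightarrow> int" where
  "shift_op n i j = (j + 1) mod int n"

definition twisted_shift_op :: "nat \<Rightarrow> (int \<Rightarrow> int) \<Rightarrow> int \<Rightarrow> int \<Rightarrow> int" where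
  "twisted_shift_op p f i j = (j + 1 + int p * f (i mod int p)) mod int (p\<^sup>2)"

definition prod_op :: "nat \<Rightarrow> int \<times> int \<Rightarrow> int \<times> int \<Rightarrow> int \<times> int" where
  "prod_op p = (\<lambda>(i, s) (j, t). ((j + 1) mod int p, (t + i) mod int p))"

text \<open>
  The functions from residue classes modulo \<open>p\<close> to \<open>{0..p-1}\<close> of the form \<open>l \<mapsto> l t\<close> with \<open>t \<noteq> 0\<close>,
  as extensional functions so that each of them is counted once.
\<close>

definition linear_maps :: "nat \<Rightarrow> (int \<Rightarrow> int) set" where
  "linear_maps p = {f. \<exists>t\<in>Zmod p. t \<noteq> 0 \<and> f = (\<lambda>l\<in>Zmod p. (l * t) mod int p)}"

end

theory Submission
  imports Defs "HOL-Algebra.Multiplicative_Group"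
begin

text \<open>
  An abelian transitive permutation group is regular, so an indecomposable cycle set with abelian
  permutation group \<open>G\<close> can be transported to \<open>G\<close> itself: the operation becomes
  \<open>x \<cdot> y = l x \<otimes> y\<close> for a map \<open>l: G \<rightarrow> G\<close> whose image generates \<open>G\<close>, and the cycle set law turns into
  \<open>l x \<otimes> l (y \<otimes> l x) = l y \<otimes> l (x \<otimes> l y)\<close> (\<open>indecomposable_abelian_translation_model\<close>). Conversely
  every such \<open>l\<close> gives an indecomposable cycle set with permutation group isomorphic to \<open>G\<close>
  (\<open>translation_cycle_set_properties\<close>). It remains to find all \<open>l\<close> when \<open>G\<close> has order \<open>p q\<close>.

  The law makes the non-empty fibres of \<open>l\<close> the cosets of a subgroup \<open>N\<close>, and likewise for the map
  that \<open>l\<close> induces on \<open>G / N\<close>. The decisive point is that \<open>N\<close> is never trivial unless \<open>G\<close> is: otherwise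
  \<open>l\<close> would be a bijection, hence would take the value \<open>\<one>\<close> somewhere; the law then spreads this value
  along all translations by elements of the image, so \<open>l\<close> would be constantly \<open>\<one>\<close>, although its image
  generates \<open>G\<close>. Applied to \<open>G / N\<close> as well (\<open>retract_kernel_fixed_imp_top\<close>), this leaves only two
  possibilities in order \<open>p q\<close>.

  \<^item> \<open>N = G\<close>: then \<open>l\<close> is constant, its value \<open>a\<close> generates \<open>G\<close>, and \<open>a\<^sup>k \<mapsto> k\<close> identifies the cycle set
    with the shift.

  \<^item> \<open>N\<close> has prime order and \<open>l\<close> is constant modulo \<open>N\<close>. With \<open>a = l \<one>\<close> the law gives
    \<open>l (x \<otimes> a) = l x \<otimes> d\<close> for a fixed \<open>d \<in> N\<close>, hence \<open>l (a\<^sup>k \<otimes> n) = a \<otimes> d\<^sup>k\<close> for \<open>n \<in> N\<close>. Here \<open>d\<close> generates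
    \<open>N\<close>, and reading off \<open>k\<close> from \<open>d\<^sup>k\<close> shows that \<open>(k, m) \<mapsto> a\<^sup>k \<otimes> d\<^sup>m\<close> is a bijection onto \<open>G\<close> with both
    exponents modulo the order of \<open>N\<close>; so \<open>p = q\<close> (\<open>nonconstant_structure\<close>). If \<open>a\<^sup>p = \<one>\<close>, this bijection
    is the isomorphism with the third family. Otherwise \<open>a\<close> generates \<open>G\<close>, \<open>d\<close> is a power
    \<open>a\<^bsup>p t\<^esup>\<close> with \<open>t \<noteq> 0\<close>, and \<open>l (a\<^sup>k) = a\<^bsup>1 + p t k\<^esup>\<close> is the second family.

  The shift and the second family are treated uniformly as operations
  \<open>i \<cdot> j = j + 1 + c i\<close> on \<open>\<int>/n\<close>. The parameter \<open>t\<close> with \<open>c = p t\<close> is an isomorphism invariant, because an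
  isomorphism intertwines the left multiplications by \<open>0\<close> and by the image of \<open>0\<close>, and is therefore
  affine with slope \<open>1\<close> modulo \<open>p\<close>. The third family is told apart by its left multiplications having order \<open>p\<close>.
\<close>

section \<open>Isomorphisms of cycle sets\<close>

lemma cycle_set_isomorphic_trans:
  assumes "cycle_set_isomorphic A f B g" "cycle_set_isomorphic B g C h"
  shows "cycle_set_isomorphic A f C h"
proof -
  obtain \<phi> \<psi> where \<phi>: "bij_betw \<phi> A B" "\<forall>x\<in>A. \<forall>y\<in>A. \<phi> (f x y) = g (\<phi> x) (\<phi> y)"
    and \<psi>: "bij_betw \<psi> B C" "\<forall>x\<in>B. \<forall>y\<in>B. \<psi> (g x y) = h (\<psi> x) (\<psi> y)"
    using assms unfolding cycle_set_isomorphic_def by blast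
  have "(\<psi> \<circ> \<phi>) (f x y) = h ((\<psi> \<circ> \<phi>) x) ((\<psi> \<circ> \<phi>) y)" if "x \<in> A" "y \<in> A" for x y
    using that \<phi>(2) \<psi>(2) bij_betwE[OF \<phi>(1)] by simp
  then show ?thesis
    using bij_betw_trans[OF \<phi>(1) \<psi>(1)] unfolding cycle_set_isomorphic_def by blast
qed

lemma cycle_set_isomorphic_sym:
  assumes "cycle_set_isomorphic A f B g" and closed: "\<And>x y. x \<in> A \<Longrightarrow> y \<in> A \<Longrightarrow> f x y \<in> A"
  shows "cycle_set_isomorphic B g A f"
proof -
  obtain \<phi> where bij: "bij_betw \<phi> A B" and hom: "\<forall>x\<in>A. \<forall>y\<in>A. \<phi> (f x y) = g (\<phi> x) (\<phi> y)"
    using assms(1) unfolding cycle_set_isomorphic_def by blast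
  define \<psi> where "\<psi> = inv_into A \<phi>"
  have \<psi>: "\<psi> x \<in> A" "\<phi> (\<psi> x) = x" if "x \<in> B" for x
    using bij_betwE[OF bij_betw_inv_into[OF bij]] bij_betw_inv_into_right[OF bij] that
    by (auto simp: \<psi>_def)
  have "\<psi> (g x y) = f (\<psi> x) (\<psi> y)" if "x \<in> B" "y \<in> B" for x y
  proof -
    have "g x y = \<phi> (f (\<psi> x) (\<psi> y))" using hom \<psi> that by simp
    then show ?thesis
      using bij_betw_inv_into_left[OF bij closed] \<psi>(1) that by (simp add: \<psi>_def)
  qed
  then show ?thesis
    using bij_betw_inv_into[OF bij] unfolding cycle_set_isomorphic_def \<psi>_def by blast
qed

section \<open>Generation and cyclic subgroups in finite groups\<close>

text \<open>
  In a finite group inverses are powers, so a property that survives right multiplication by the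
  generators survives right multiplication by everything they generate. This lets the cycle set law,
  which only speaks about translations by values of \<open>l\<close>, reach all translations.
\<close>

lemma (in group) generate_right_induct:
  assumes fin: "finite (carrier G)" and K: "K \<subseteq> carrier G" and g: "g \<in> generate G K"
    and one: "P \<one>"
    and step: "\<And>g k. g \<in> carrier G \<Longrightarrow> k \<in> K \<Longrightarrow> P g \<Longrightarrow> P (g \<otimes> k)"
  shows "P g"
proof -
  have in_G: "g \<in> carrier G" if "g \<in> generate G K" for g
    using generate_incl[OF K] that by blast
  have pow: "P (x \<otimes> k [^] n)" if "x \<in> carrier G" "k \<in> K" "P x" for x k and n :: nat
  proof (induction n)
    case (Suc n)
    have "x \<otimes> k [^] Suc n = (x \<otimes> k [^] n) \<otimes> k"
      using that K by (simp add: m_assoc subset_iff)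
    then show ?case using step[OF _ that(2) Suc] that K by (auto simp: subset_iff)
  qed (use that in simp)
  have "\<forall>x\<in>carrier G. P x \<longrightarrow> P (x \<otimes> g)"
    using g
  proof induction
    case (inv k)
    then have k: "k \<in> carrier G" using K by blast
    have "ord k > 0" using ord_ge_1[OF fin k] by simp
    then have "k [^] (ord k - 1) \<otimes> k = \<one>"
      using nat_pow_Suc[of k "ord k - 1"] pow_ord_eq_1[OF k] by simp
    then have "inv k = k [^] (ord k - 1)"
      using inv_equality[of "k [^] (ord k - 1)" k] k by simp
    then show ?case using pow[OF _ inv] by auto
  next
    case (eng h1 h2)
    then show ?case using in_G by (simp flip: m_assoc)
  qed (use step in auto)
  then show ?thesis using one in_G[OF g] by auto
qed

lemma dvd_prime_prod_cases:
  fixes p q n :: nat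
  assumes "prime p" "prime q" "n dvd p * q"
  shows "n \<in> {1, p, q, p * q}"
proof -
  obtain b c where "n = b * c" "b dvd p" "c dvd q"
    using assms(3) division_decomp by blast
  moreover from this have "b \<in> {1, p}" "c \<in> {1, q}" using assms(1,2) by (auto simp: prime_nat_iff)
  ultimately show ?thesis by auto
qed

lemma Zmod_cong_imp_eq:
  assumes "x \<in> Zmod n" "y \<in> Zmod n" "int n dvd y - x"
  shows "x = y"
  using assms by (metis atLeastLessThan_iff mod_eq_dvd_iff mod_pos_pos_trivial)

context group
begin

lemma int_pow_mod:
  assumes "x \<in> carrier G" "ord x dvd n"
  shows "x [^] (k mod int n) = x [^] k"
  using assms by (simp add: int_pow_eq)
    (metis dvd_trans int_dvd_int_iff minus_mod_eq_mult_div dvd_triv_left)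

lemma generate_subset_Zmod_pow:
  assumes "x \<in> carrier G" "0 < ord x" "y \<in> generate G {x}"
  obtains k where "k \<in> Zmod (ord x)" "y = x [^] k"
proof -
  obtain k :: int where "y = x [^] k" using generate_pow assms(1,3) by auto
  then have "y = x [^] (k mod int (ord x))" using assms(1) by (simp add: int_pow_mod)
  then show thesis using that[of "k mod int (ord x)"] assms(2) by simp
qed

lemma bij_betw_Zmod_pow:
  assumes "x \<in> carrier G" "0 < ord x"
  shows "bij_betw (\<lambda>k. x [^] k) (Zmod (ord x)) (generate G {x})"
proof (rule bij_betw_imageI)
  show "inj_on (\<lambda>k. x [^] k) (Zmod (ord x))"
    using assms Zmod_cong_imp_eq by (intro inj_onI) (auto simp: int_pow_eq)
  show "(\<lambda>k. x [^] k) ` Zmod (ord x) = generate G {x}"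
    using generate_subset_Zmod_pow[OF assms] generate_pow[OF assms(1)] by blast
qed

lemma prime_card_subgroup_generated:
  assumes N: "subgroup N G" and pr: "prime (card N)" and d: "d \<in> N" "d \<noteq> \<one>"
  shows "generate G {d} = N" and "ord d = card N"
proof -
  have dG: "d \<in> carrier G" using N d(1) by (rule subgroup.mem_carrier)
  interpret GN: group "G\<lparr>carrier := N\<rparr>" by (rule subgroup.subgroup_is_group[OF N group_axioms])
  have "d [^]\<^bsub>G\<lparr>carrier := N\<rparr>\<^esub> order (G\<lparr>carrier := N\<rparr>) = \<one>"
    using GN.pow_order_eq_1[of d] d(1) by simp
  then have "d [^] card N = \<one>" by (simp add: order_def flip: nat_pow_consistent)
  then have "ord d dvd card N" using dG by (simp add: pow_eq_id)
  then show ord: "ord d = card N"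
    using pr d(2) dG by (metis ord_eq_1 prime_nat_iff)
  have sub: "generate G {d} \<subseteq> N" using generate_subgroup_incl[OF _ N, of "{d}"] d(1) by simp
  moreover have "finite N" using pr by (metis card.infinite not_prime_0)
  ultimately show "generate G {d} = N"
    using ord generate_pow_card[OF dG] by (metis card_subset_eq)
qed

end

section \<open>Translation cycle sets and their retractions\<close>

text \<open>
  The cycle set is \<open>x \<cdot> y = l x \<otimes> y\<close> on the carrier of \<open>G\<close>; \<open>l_law\<close> is what its cycle set law says after
  cancelling the common factor \<open>z\<close>, and \<open>l_generates\<close> expresses indecomposability.
\<close>

locale abelian_translation_cycle_set = comm_group G for G (structure) +
  fixes l :: "'a \<Rightarrow> 'a"
  assumes finite_carrier: "finite (carrier G)"
    and l_closed [simp]: "x \<in> carrier G \<Longrightarrow> l x \<in> carrier G"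
    and l_law: "x \<in> carrier G \<Longrightarrow> y \<in> carrier G \<Longrightarrow>
          l x \<otimes> l (y \<otimes> l x) = l y \<otimes> l (x \<otimes> l y)"
    and l_generates: "generate G (l ` carrier G) = carrier G"
begin

lemma translation_induct [consumes 1, case_names one step]:
  assumes "g \<in> carrier G" and "P \<one>"
    and "\<And>g z. g \<in> carrier G \<Longrightarrow> z \<in> carrier G \<Longrightarrow> P g \<Longrightarrow> P (g \<otimes> l z)"
  shows "P g"
  by (rule generate_right_induct[of "l ` carrier G"])
    (use finite_carrier l_generates assms in auto)

lemma rcos_mult_cong:
  assumes "subgroup N G" "x \<in> carrier G" "x' \<in> carrier G" "y \<in> carrier G" "y' \<in> carrier G"
    and "N #> x = N #> x'" "N #> y = N #> y'"
  shows "N #> x \<otimes> y = N #> x' \<otimes> y'"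
  by (metis assms coset_mult_assoc m_comm subgroup.subset)

lemma rcos_mult_cancel:
  assumes "subgroup N G" "x \<in> carrier G" "y \<in> carrier G" "z \<in> carrier G"
    and "N #> x \<otimes> z = N #> y \<otimes> z"
  shows "N #> x = N #> y"
proof -
  have "N #> (x \<otimes> z) \<otimes> inv z = N #> (y \<otimes> z) \<otimes> inv z"
    using rcos_mult_cong[OF assms(1) _ _ _ _ assms(5)] assms by simp
  then show ?thesis using assms by (simp add: m_assoc)
qed

lemma rcos_eq_self_iff: "subgroup N G \<Longrightarrow> x \<in> carrier G \<Longrightarrow> N #> x = N \<longleftrightarrow> x \<in> N"
  using coset_join1 coset_join2 subgroup.subset by blast

text \<open>
  For \<open>N = {\<one>}\<close> the cosets of the retract kernel are the classes of the relation "equal left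
  multiplications", that is, the fibres of the retraction of the cycle set. For larger \<open>N\<close> it is the
  preimage in \<open>G\<close> of the same subgroup for the cycle set induced on \<open>G / N\<close>, which exists when \<open>l\<close> respects
  the cosets of \<open>N\<close>. Working in \<open>G\<close> with congruences modulo \<open>N\<close> keeps iterated retractions in one group.
\<close>

definition retract_kernel :: "'a set \<Rightarrow> 'a set" where
  "retract_kernel N = {h \<in> carrier G. N #> l h = N #> l \<one>}"

definition respects_cosets :: "'a set \<Rightarrow> bool" where
  "respects_cosets N \<longleftrightarrow> (\<forall>x\<in>carrier G. \<forall>y\<in>carrier G. N #> x = N #> y \<longrightarrow> N #> l x = N #> l y)"

lemma respects_cosetsD:
  "respects_cosets N \<Longrightarrow> N #> x = N #> y \<Longrightarrow> x \<in> carrier G \<Longrightarrow> y \<in> carrier G \<Longrightarrow>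
     N #> l x = N #> l y"
  unfolding respects_cosets_def by blast

text \<open>
  The law expresses \<open>l (x \<otimes> l z)\<close> through \<open>l x\<close> and \<open>l (z \<otimes> l x)\<close>, so modulo \<open>N\<close> it depends on \<open>l x\<close> and \<open>z\<close> only;
  induction over the generators \<open>l z\<close> extends this to all translations.
\<close>

lemma l_translate:
  assumes N: "subgroup N G" and resp: "respects_cosets N"
    and x: "x \<in> carrier G" and y: "y \<in> carrier G" and g: "g \<in> carrier G"
    and eq: "N #> l x = N #> l y"
  shows "N #> l (x \<otimes> g) = N #> l (y \<otimes> g)"
  using g
proof (induction g rule: translation_induct)
  case one
  then show ?case using eq x y by simp
next
  case (step g z)
  define u where "u = x \<otimes> g"
  define v where "v = y \<otimes> g"
  have uv: "u \<in> carrier G" "v \<in> carrier G" "N #> l u = N #> l v"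
    using step x y by (auto simp: u_def v_def)
  have "N #> z \<otimes> l u = N #> z \<otimes> l v"
    by (rule rcos_mult_cong[OF N _ _ _ _ refl uv(3)]) (use step(1,2) uv(1,2) in simp_all)
  then have "N #> l (z \<otimes> l u) = N #> l (z \<otimes> l v)"
    by (rule respects_cosetsD[OF resp]) (use step(1,2) uv(1,2) in simp_all)
  then have "N #> l u \<otimes> l (z \<otimes> l u) = N #> l v \<otimes> l (z \<otimes> l v)"
    by (rule rcos_mult_cong[OF N _ _ _ _ uv(3), rotated -1]) (use step(1,2) uv(1,2) in simp_all)
  then have "N #> l (u \<otimes> l z) \<otimes> l z = N #> l (v \<otimes> l z) \<otimes> l z"
    using l_law[of u z] l_law[of v z] step(1,2) uv(1,2) by (simp add: m_comm)
  then have "N #> l (u \<otimes> l z) = N #> l (v \<otimes> l z)"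
    by (rule rcos_mult_cancel[OF N, rotated -1]) (use step(1,2) uv(1,2) in simp_all)
  then show ?case using step(1,2) x y by (simp add: u_def v_def m_assoc)
qed

lemma subgroup_retract_kernel:
  assumes N: "subgroup N G" and resp: "respects_cosets N"
  shows "subgroup (retract_kernel N) G"
proof
  fix x y assume xy: "x \<in> retract_kernel N" "y \<in> retract_kernel N"
  then have "N #> l (x \<otimes> y) = N #> l (\<one> \<otimes> y)"
    using l_translate[OF N resp, of x \<one> y] by (simp add: retract_kernel_def)
  then show "x \<otimes> y \<in> retract_kernel N" using xy by (simp add: retract_kernel_def)
next
  fix x assume x: "x \<in> retract_kernel N"
  then have "N #> l (x \<otimes> inv x) = N #> l (\<one> \<otimes> inv x)"
    using l_translate[OF N resp, of x \<one> "inv x"] by (simp add: retract_kernel_def)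
  then show "inv x \<in> retract_kernel N" using x by (simp add: retract_kernel_def)
qed (auto simp: retract_kernel_def)

text \<open>
  Translating by \<open>y\<close> and by its inverse moves the comparison of \<open>x\<close> and \<open>y\<close> to one of
  \<open>x \<otimes> inv y\<close> and \<open>\<one>\<close>.
\<close>

lemma rcos_retract_kernel_iff:
  assumes N: "subgroup N G" and resp: "respects_cosets N"
    and x: "x \<in> carrier G" and y: "y \<in> carrier G"
  shows "retract_kernel N #> x = retract_kernel N #> y \<longleftrightarrow> N #> l x = N #> l y"
proof -
  note R = subgroup_retract_kernel[OF N resp]
  have "retract_kernel N #> x = retract_kernel N #> y \<longleftrightarrow> x \<otimes> inv y \<in> retract_kernel N"
    using subgroup.rcos_module[OF R group_axioms y x] repr_independence[OF _ y R]
      rcos_self[OF x R] by blast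
  also have "\<dots> \<longleftrightarrow> N #> l x = N #> l y"
  proof
    assume "x \<otimes> inv y \<in> retract_kernel N"
    then have "N #> l (x \<otimes> inv y \<otimes> y) = N #> l (\<one> \<otimes> y)"
      using l_translate[OF N resp, of "x \<otimes> inv y" \<one> y] x y
      unfolding retract_kernel_def by blast
    then show "N #> l x = N #> l y" using x y by (simp add: m_assoc)
  next
    assume "N #> l x = N #> l y"
    then have "N #> l (x \<otimes> inv y) = N #> l (y \<otimes> inv y)"
      using l_translate[OF N resp, of x y "inv y"] x y by blast
    then show "x \<otimes> inv y \<in> retract_kernel N" using x y by (simp add: retract_kernel_def)
  qed
  finally show ?thesis .
qed

lemma respects_cosets_retract_kernel:
  assumes N: "subgroup N G" and resp: "respects_cosets N"
  shows "N \<subseteq> retract_kernel N" and "respects_cosets (retract_kernel N)"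
proof -
  show "N \<subseteq> retract_kernel N"
  proof
    fix h assume h: "h \<in> N"
    then have "h \<in> carrier G" by (rule subgroup.mem_carrier[OF N])
    moreover from this have "N #> h = N #> \<one>"
      using h rcos_eq_self_iff[OF N, of h] subgroup.subset[OF N] by simp
    ultimately show "h \<in> retract_kernel N"
      using respects_cosetsD[OF resp, of h \<one>] by (simp add: retract_kernel_def)
  qed
  show "respects_cosets (retract_kernel N)"
    unfolding respects_cosets_def
  proof (intro ballI impI)
    fix x y assume xy: "x \<in> carrier G" "y \<in> carrier G" "retract_kernel N #> x = retract_kernel N #> y"
    then have "N #> l (l x) = N #> l (l y)"
      using rcos_retract_kernel_iff[OF N resp xy(1,2)] respects_cosetsD[OF resp, of "l x" "l y"]
      by simp
    then show "retract_kernel N #> l x = retract_kernel N #> l y"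
      using rcos_retract_kernel_iff[OF N resp, of "l x" "l y"] xy(1,2) by simp
  qed
qed

text \<open>
  No non-trivial translation cycle set on a finite abelian group is irretractable. If the retraction
  is injective on \<open>G / N\<close>, then by finiteness some value \<open>l x\<close> lies in \<open>N\<close>. Inserting such an \<open>x\<close> into the law
  gives \<open>l (x \<otimes> l z) \<in> N\<close> for every \<open>z\<close>, so all values of \<open>l\<close> lie in \<open>N\<close>, and they generate \<open>G\<close>.
\<close>

lemma retract_kernel_fixed_imp_top:
  assumes N: "subgroup N G" and resp: "respects_cosets N" and fixed: "retract_kernel N = N"
  shows "N = carrier G"
proof -
  have NG: "N \<subseteq> carrier G" by (rule subgroup.subset[OF N])
  \<comment> \<open>the induced self-map of the set of cosets, on chosen representatives\<close>
  define Q where "Q = (\<lambda>x. N #> x) ` carrier G"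
  define r where "r = inv_into (carrier G) (\<lambda>x. N #> x)"
  have r: "r C \<in> carrier G" "N #> r C = C" if "C \<in> Q" for C
    using inv_into_into[OF that[unfolded Q_def]] f_inv_into_f[OF that[unfolded Q_def]]
    by (simp_all add: r_def)
  define f where "f = (\<lambda>C. N #> l (r C))"
  have "finite Q" unfolding Q_def using finite_carrier by (rule finite_imageI)
  moreover have "f ` Q \<subseteq> Q"
    using r(1) l_closed unfolding f_def Q_def by blast
  moreover have "inj_on f Q"
  proof (rule inj_onI)
    fix C C' assume C: "C \<in> Q" "C' \<in> Q" and eq: "f C = f C'"
    have "N #> r C = N #> r C'"
      using rcos_retract_kernel_iff[OF N resp r(1)[OF C(1)] r(1)[OF C(2)]] eq
      unfolding fixed f_def by blast
    then show "C = C'" unfolding r(2)[OF C(1)] r(2)[OF C(2)] .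
  qed
  ultimately have "f ` Q = Q"
    by (rule endo_inj_surj)
  moreover have "N \<in> Q"
    unfolding Q_def using coset_mult_one[OF NG] by (metis image_eqI one_closed)
  ultimately obtain C where C: "C \<in> Q" "f C = N" by (metis imageE)
  define x where "x = r C"
  have x: "x \<in> carrier G" "N #> l x = N"
    using r(1)[OF C(1)] C(2) unfolding f_def x_def by blast+
  have shift: "N #> l (x \<otimes> g) = N" if "g \<in> carrier G" for g
    using that
  proof (induction g rule: translation_induct)
    case (step g z)
    define u where "u = x \<otimes> g"
    have u: "u \<in> carrier G" "N #> l u = N" using step x by (simp_all add: u_def)
    have u1: "N #> l u = N #> \<one>" using u(2) NG by simp
    have "N #> z \<otimes> l u = N #> z \<otimes> \<one>"
      by (rule rcos_mult_cong[OF N _ _ _ _ refl u1]) (use step(1,2) u(1) in simp_all)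
    then have "N #> l (z \<otimes> l u) = N #> l z"
      using respects_cosetsD[OF resp, of "z \<otimes> l u" z] u(1) step(2) by simp
    then have "N #> l u \<otimes> l (z \<otimes> l u) = N #> \<one> \<otimes> l z"
      by (rule rcos_mult_cong[OF N _ _ _ _ u1, rotated -1]) (use step(1,2) u(1) in simp_all)
    then have "N #> l (u \<otimes> l z) \<otimes> l z = N #> \<one> \<otimes> l z"
      using l_law[of u z] u(1) step(1,2) by (simp add: m_comm)
    then have "N #> l (u \<otimes> l z) = N #> \<one>"
      by (rule rcos_mult_cancel[OF N, rotated -1]) (use step(1,2) u(1) in simp_all)
    then show ?case using step(1,2) NG x(1) by (simp add: u_def m_assoc)
  qed (use x in simp)
  have "l y \<in> N" if y: "y \<in> carrier G" for y
  proof -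
    have "x \<otimes> (inv x \<otimes> y) = y" using x y by (simp flip: m_assoc)
    then show ?thesis using shift[of "inv x \<otimes> y"] rcos_eq_self_iff[OF N, of "l y"] x y by simp
  qed
  then have "generate G (l ` carrier G) \<subseteq> N"
    using N by (intro generate_subgroup_incl) auto
  then show ?thesis using l_generates N subgroup.subset by blast
qed

end

section \<open>Regular representation of indecomposable abelian cycle sets\<close>

lemma carrier_BijGroup [simp]: "carrier (BijGroup S) = Bij S"
  and one_BijGroup [simp]: "\<one>\<^bsub>BijGroup S\<^esub> = (\<lambda>x\<in>S. x)"
  by (simp_all add: BijGroup_def)

lemma mult_BijGroup_apply:
  "g \<in> Bij S \<Longrightarrow> h \<in> Bij S \<Longrightarrow> x \<in> S \<Longrightarrow> (g \<otimes>\<^bsub>BijGroup S\<^esub> h) x = g (h x)"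
  by (simp add: BijGroup_def compose_eq)

lemma (in cycle_set) left_mult_in_Bij: "x \<in> S \<Longrightarrow> left_mult S (\<cdot>) x \<in> Bij S"
  unfolding Bij_def left_mult_def
  using bij_left_mult[of x] bij_betw_cong[of S "\<lambda>y\<in>S. x \<cdot> y" "\<lambda>y. x \<cdot> y" S] by simp

text \<open>
  Transitivity follows from indecomposability because the orbit of a point and its complement are both
  invariant. An element of an abelian transitive group that agrees with another one at \<open>x0\<close> agrees
  with it everywhere, so evaluation at \<open>x0\<close> is a bijection from the permutation group to \<open>S\<close>. Under it the
  left multiplication by \<open>g x0\<close> becomes the translation by \<open>l g\<close>, that very left multiplication seen as an
  element of the group.
\<close>

theorem indecomposable_abelian_translation_model:
  assumes "indecomposable_abelian n S opr" and n: "0 < n"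
  obtains l where "abelian_translation_cycle_set (permutation_group S opr) l"
    and "order (permutation_group S opr) = n"
    and "cycle_set_isomorphic (carrier (permutation_group S opr))
           (\<lambda>x y. l x \<otimes>\<^bsub>permutation_group S opr\<^esub> y) S opr"
proof -
  interpret cycle_set S opr using assms(1) by (simp add: indecomposable_abelian_def)
  have card: "card S = n" and indec: "indecomposable S opr"
    and comm: "comm_group (permutation_group S opr)"
    using assms(1) by (simp_all add: indecomposable_abelian_def)
  have finS: "finite S" using card n by (metis card.infinite less_irrefl)
  define G where "G = permutation_group S opr"
  interpret G: comm_group G using comm by (simp add: G_def)
  interpret B: group "BijGroup S" by (rule group_BijGroup)
  define \<sigma> where "\<sigma> = left_mult S opr"
  have \<sigma>_Bij: "\<sigma> x \<in> Bij S" if "x \<in> S" for x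
    using left_mult_in_Bij[OF that] by (simp add: \<sigma>_def)
  have \<sigma>_apply: "\<sigma> x y = opr x y" if "y \<in> S" for x y
    using that by (simp add: \<sigma>_def left_mult_def)
  have G_alt: "G = subgroup_generated (BijGroup S) (\<sigma> ` S)"
    by (simp add: G_def permutation_group_def \<sigma>_def)
  have G_Bij: "g \<in> Bij S" if "g \<in> carrier G" for g
    using that B.carrier_subgroup_generated_subset[of "\<sigma> ` S"] unfolding G_alt by auto
  have \<sigma>_G: "\<sigma> x \<in> carrier G" if "x \<in> S" for x
    using that B.subgroup_generated_subset_carrier_subset[of "\<sigma> ` S"] \<sigma>_Bij unfolding G_alt by auto
  have G_closed: "g x \<in> S" if "g \<in> carrier G" "x \<in> S" for g x
    using Bij_imp_funcset[OF G_Bij[OF that(1)]] that(2) by blast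
  have G_mult: "(g \<otimes>\<^bsub>G\<^esub> h) x = g (h x)" if "g \<in> carrier G" "h \<in> carrier G" "x \<in> S" for g h x
    using mult_BijGroup_apply[OF G_Bij G_Bij] that unfolding G_alt by simp
  have G_one: "\<one>\<^bsub>G\<^esub> x = x" if "x \<in> S" for x
    using that by (simp add: G_alt)
  have G_ext: "g = h" if "g \<in> carrier G" "h \<in> carrier G" "\<And>x. x \<in> S \<Longrightarrow> g x = h x" for g h
    using extensionalityI[OF Bij_imp_extensional[OF G_Bij] Bij_imp_extensional[OF G_Bij]] that .
  obtain x0 where x0: "x0 \<in> S" using nonempty by blast
  define Y where "Y = (\<lambda>g. g x0) ` carrier G"
  have YS: "Y \<subseteq> S" using G_closed x0 by (auto simp: Y_def)
  have transitive: "Y = S"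
  proof (rule ccontr)
    assume "Y \<noteq> S"
    have inv_Y: "\<sigma> x ` Y \<subseteq> Y" if x: "x \<in> S" for x
    proof
      fix y assume "y \<in> \<sigma> x ` Y"
      then obtain g where g: "g \<in> carrier G" "y = \<sigma> x (g x0)" unfolding Y_def by blast
      then have "y = (\<sigma> x \<otimes>\<^bsub>G\<^esub> g) x0" using G_mult \<sigma>_G x x0 by simp
      then show "y \<in> Y" unfolding Y_def using g \<sigma>_G[OF x] by blast
    qed
    have inv_Z: "\<sigma> x ` (S - Y) \<subseteq> S - Y" if x: "x \<in> S" for x
    proof
      fix y assume "y \<in> \<sigma> x ` (S - Y)"
      then obtain z where z: "z \<in> S" "z \<notin> Y" "y = \<sigma> x z" by blast
      have "y \<notin> Y"
      proof
        assume "y \<in> Y"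
        then obtain g where g: "g \<in> carrier G" "y = g x0" unfolding Y_def by blast
        have inv: "inv\<^bsub>G\<^esub> \<sigma> x \<in> carrier G" using \<sigma>_G[OF x] by simp
        have "z = (inv\<^bsub>G\<^esub> \<sigma> x \<otimes>\<^bsub>G\<^esub> \<sigma> x) z" using \<sigma>_G[OF x] z G_one by simp
        also have "\<dots> = (inv\<^bsub>G\<^esub> \<sigma> x \<otimes>\<^bsub>G\<^esub> g) x0"
          using G_mult[OF inv \<sigma>_G[OF x] z(1)] G_mult[OF inv g(1) x0] g(2) z(3) by simp
        finally have "z \<in> Y" unfolding Y_def using inv g(1) by blast
        then show False using z by blast
      qed
      then show "y \<in> S - Y" using z G_closed[OF \<sigma>_G[OF x]] by blast
    qed
    have "Y \<noteq> {}" unfolding Y_def using G.one_closed by blast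
    moreover have "S - Y \<noteq> {}" using YS \<open>Y \<noteq> S\<close> by blast
    moreover have "Y \<inter> (S - Y) = {}" "Y \<union> (S - Y) = S" using YS by blast+
    moreover have "\<forall>x\<in>S. \<sigma> x ` Y \<subseteq> Y \<and> \<sigma> x ` (S - Y) \<subseteq> S - Y"
      using inv_Y inv_Z by (intro ballI conjI)
    ultimately have "\<exists>Y Z. Y \<noteq> {} \<and> Z \<noteq> {} \<and> Y \<inter> Z = {} \<and> Y \<union> Z = S \<and>
        (\<forall>x\<in>S. \<sigma> x ` Y \<subseteq> Y \<and> \<sigma> x ` Z \<subseteq> Z)"
      by (intro exI[of _ Y] exI[of _ "S - Y"] conjI)
    then show False
      using indec unfolding indecomposable_def \<sigma>_def by (rule notE[rotated])
  qed
  have inj: "inj_on (\<lambda>g. g x0) (carrier G)"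
  proof (rule inj_onI)
    fix g h assume gh: "g \<in> carrier G" "h \<in> carrier G" "g x0 = h x0"
    show "g = h"
    proof (rule G_ext[OF gh(1,2)])
      fix x assume "x \<in> S"
      then have "x \<in> Y" by (simp add: transitive)
      then obtain k where k: "k \<in> carrier G" "x = k x0" unfolding Y_def by blast
      have "g x = (k \<otimes>\<^bsub>G\<^esub> g) x0" using G_mult[OF gh(1) k(1) x0] G.m_comm[OF gh(1) k(1)] k(2) by simp
      also have "\<dots> = (k \<otimes>\<^bsub>G\<^esub> h) x0" using G_mult[OF k(1) gh(1) x0] G_mult[OF k(1) gh(2) x0] gh(3) by simp
      also have "\<dots> = h x" using G_mult[OF gh(2) k(1) x0] G.m_comm[OF gh(2) k(1)] k(2) by simp
      finally show "g x = h x" .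
    qed
  qed
  have bij: "bij_betw (\<lambda>g. g x0) (carrier G) S"
    using inj transitive unfolding Y_def by (rule bij_betw_imageI)
  define l where "l g = \<sigma> (g x0)" for g
  have lG: "l g \<in> carrier G" if "g \<in> carrier G" for g
    using \<sigma>_G[OF G_closed[OF that x0]] by (simp add: l_def)
  have l_apply: "(l g \<otimes>\<^bsub>G\<^esub> h) x0 = opr (g x0) (h x0)" if "g \<in> carrier G" "h \<in> carrier G" for g h
    using G_mult[OF lG[OF that(1)] that(2) x0] \<sigma>_apply[OF G_closed[OF that(2) x0]]
    by (simp add: l_def)
  have l_image: "l ` carrier G = \<sigma> ` S"
  proof -
    have "l ` carrier G = \<sigma> ` Y" by (simp add: Y_def l_def image_image)
    then show ?thesis by (simp only: transitive)
  qed
  have "abelian_translation_cycle_set G l"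
  proof
    show "finite (carrier G)" using bij_betw_finite[OF bij] finS by simp
    show "l x \<in> carrier G" if "x \<in> carrier G" for x using lG[OF that] .
    show "generate G (l ` carrier G) = carrier G"
    proof -
      have "subgroup_generated G (\<sigma> ` S) = G" by (simp add: G_alt)
      then have "generate G (carrier G \<inter> \<sigma> ` S) = carrier G"
        by (metis carrier_subgroup_generated)
      moreover have "carrier G \<inter> \<sigma> ` S = \<sigma> ` S" using \<sigma>_G by blast
      ultimately show ?thesis by (simp add: l_image)
    qed
    fix g h assume gh: "g \<in> carrier G" "h \<in> carrier G"
    \<comment> \<open>at the points of \<open>S\<close>, the two sides of the law are the two sides of the cycle set law\<close>
    have key: "(l (h \<otimes>\<^bsub>G\<^esub> l g) \<otimes>\<^bsub>G\<^esub> l g) x = opr (opr (g x0) (h x0)) (opr (g x0) x)"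
      if "g \<in> carrier G" "h \<in> carrier G" "x \<in> S" for g h x
    proof -
      have "(l (h \<otimes>\<^bsub>G\<^esub> l g) \<otimes>\<^bsub>G\<^esub> l g) x = \<sigma> ((l g \<otimes>\<^bsub>G\<^esub> h) x0) (\<sigma> (g x0) x)"
        using G_mult[of "l (h \<otimes>\<^bsub>G\<^esub> l g)" "l g" x] lG that G.m_comm[of h "l g"] by (simp add: l_def)
      then show ?thesis
        using l_apply[OF that(1,2)] \<sigma>_apply that(3) G_closed[OF \<sigma>_G[OF G_closed[OF that(1) x0]] that(3)]
        by simp
    qed
    have "l (h \<otimes>\<^bsub>G\<^esub> l g) \<otimes>\<^bsub>G\<^esub> l g = l (g \<otimes>\<^bsub>G\<^esub> l h) \<otimes>\<^bsub>G\<^esub> l h"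
    proof (rule G_ext)
      fix x assume "x \<in> S"
      then show "(l (h \<otimes>\<^bsub>G\<^esub> l g) \<otimes>\<^bsub>G\<^esub> l g) x = (l (g \<otimes>\<^bsub>G\<^esub> l h) \<otimes>\<^bsub>G\<^esub> l h) x"
        using key[OF gh] key[OF gh(2,1)] cycle_law[OF G_closed[OF gh(1) x0] G_closed[OF gh(2) x0]]
        by simp
    qed (use gh lG in auto)
    then show "l g \<otimes>\<^bsub>G\<^esub> l (h \<otimes>\<^bsub>G\<^esub> l g) = l h \<otimes>\<^bsub>G\<^esub> l (g \<otimes>\<^bsub>G\<^esub> l h)"
      using gh lG by (simp add: G.m_comm)
  qed
  moreover have "order G = n"
    using bij_betw_same_card[OF bij] card by (simp add: order_def)
  moreover have "cycle_set_isomorphic (carrier G) (\<lambda>x y. l x \<otimes>\<^bsub>G\<^esub> y) S opr"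
    unfolding cycle_set_isomorphic_def using bij l_apply by blast
  ultimately show thesis using that unfolding G_def by blast
qed

text \<open>
  The left multiplications are the translations by the values of \<open>l\<close>, so the permutation group they
  generate is the image of \<open>G\<close> under the regular representation \<open>T\<close>.
\<close>

theorem (in abelian_translation_cycle_set) translation_cycle_set_properties:
  assumes opr: "\<And>x y. x \<in> carrier G \<Longrightarrow> y \<in> carrier G \<Longrightarrow> opr x y = l x \<otimes> y"
  shows "indecomposable_abelian (order G) (carrier G) opr"
    and "permutation_group (carrier G) opr \<cong> G"
proof -
  define T where "T g = (\<lambda>y\<in>carrier G. g \<otimes> y)" for g
  have bij_T: "bij_betw (\<lambda>y. g \<otimes> y) (carrier G) (carrier G)" if g: "g \<in> carrier G" for g
    by (rule bij_betw_byWitness[of _ "\<lambda>y. inv g \<otimes> y"]) (use g in \<open>auto simp flip: m_assoc\<close>)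
  have T_Bij: "T g \<in> Bij (carrier G)" if g: "g \<in> carrier G" for g
    unfolding Bij_def T_def
    using bij_T[OF g] bij_betw_cong[of "carrier G" "\<lambda>y\<in>carrier G. g \<otimes> y" "\<lambda>y. g \<otimes> y" "carrier G"]
    by simp
  have left: "left_mult (carrier G) opr x = T (l x)" if "x \<in> carrier G" for x
    unfolding left_mult_def T_def using opr that by (intro restrict_ext) simp
  interpret B: group "BijGroup (carrier G)" by (rule group_BijGroup)
  have T_hom: "T \<in> hom G (BijGroup (carrier G))"
  proof (rule homI)
    fix g h assume gh: "g \<in> carrier G" "h \<in> carrier G"
    show "T (g \<otimes> h) = T g \<otimes>\<^bsub>BijGroup (carrier G)\<^esub> T h"
      using T_Bij gh unfolding BijGroup_def
      by (auto simp: T_def compose_def m_assoc intro!: restrict_ext)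
  qed (simp add: T_Bij)
  interpret T: group_hom G "BijGroup (carrier G)" T
    by unfold_locales (rule T_hom)
  define P where "P = permutation_group (carrier G) opr"
  have left_image: "left_mult (carrier G) opr ` carrier G = T ` l ` carrier G"
    unfolding image_image using left by (rule image_cong[OF refl])
  have "carrier P = generate (BijGroup (carrier G)) (T ` l ` carrier G)"
  proof -
    have "Bij (carrier G) \<inter> T ` l ` carrier G = T ` l ` carrier G" using T_Bij by auto
    then show ?thesis
      by (simp add: P_def permutation_group_def carrier_subgroup_generated left_image)
  qed
  also have "\<dots> = T ` carrier G"
    by (subst T.generate_img) (auto simp: l_generates)
  finally have carrier_P: "carrier P = T ` carrier G" .
  have T_inj: "inj_on T (carrier G)"
  proof (rule inj_onI)
    fix g h assume gh: "g \<in> carrier G" "h \<in> carrier G" "T g = T h"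
    have "T g \<one> = T h \<one>" by (simp only: gh(3))
    then show "g = h" using gh(1,2) by (simp add: T_def)
  qed
  have "T \<in> hom G P"
    using T_hom carrier_P by (auto simp: hom_def P_def permutation_group_def)
  then have "T \<in> iso G P"
    using T_inj carrier_P by (simp add: iso_def bij_betw_def)
  then have GP: "G \<cong> P" by (auto simp: is_iso_def)
  then show "permutation_group (carrier G) opr \<cong> G"
    unfolding P_def by (rule iso_sym)
  have "group P" by (simp add: P_def permutation_group_def)
  then have "comm_group P" using iso_imp_comm_group[OF GP] by (simp add: group.is_monoid)
  moreover have "cycle_set (carrier G) opr"
  proof
    show "bij_betw (\<lambda>y. opr x y) (carrier G) (carrier G)" if "x \<in> carrier G" for x
      using bij_T[OF l_closed[OF that]] bij_betw_cong[of "carrier G" "\<lambda>y. opr x y" "\<lambda>y. l x \<otimes> y"] opr that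
      by simp
    fix x y z assume "x \<in> carrier G" "y \<in> carrier G" "z \<in> carrier G"
    then show "opr (opr x y) (opr x z) = opr (opr y x) (opr y z)"
      using arg_cong[OF l_law[of x y], of "\<lambda>t. t \<otimes> z"] by (simp add: opr m_ac)
  qed auto
  moreover have "indecomposable (carrier G) opr"
    unfolding indecomposable_def
  proof clarify
    fix Y Z assume YZ: "Y \<noteq> {}" "Z \<noteq> {}" "Y \<inter> Z = {}" "Y \<union> Z = carrier G"
      and inv: "\<forall>x\<in>carrier G. left_mult (carrier G) opr x ` Y \<subseteq> Y \<and> left_mult (carrier G) opr x ` Z \<subseteq> Z"
    obtain y z where y: "y \<in> Y" and z: "z \<in> Z" using YZ by blast
    have yz: "y \<in> carrier G" "z \<in> carrier G" using y z YZ(4) by blast+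
    have reach: "g \<otimes> y \<in> Y" if "g \<in> carrier G" for g
      using that
    proof (induction g rule: translation_induct)
      case one
      then show ?case using y yz by simp
    next
      case (step g u)
      have "left_mult (carrier G) opr u (g \<otimes> y) \<in> Y" using inv step by blast
      then show ?case using step yz by (simp add: left T_def m_ac)
    qed
    have "z \<otimes> inv y \<otimes> y = z" using yz by (simp add: m_assoc)
    then have "z \<in> Y" using reach[of "z \<otimes> inv y"] yz by simp
    then show False using z YZ(3) by blast
  qed
  ultimately show "indecomposable_abelian (order G) (carrier G) opr"
    by (simp add: indecomposable_abelian_def order_def P_def)
qed

section \<open>Non-constant translation maps in order a product of two primes\<close>

context abelian_translation_cycle_set
begin

text \<open>
  The retract kernel \<open>N\<close> of the trivial group is proper and non-trivial, hence of prime order, and the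
  retract kernel \<open>M\<close> of \<open>N\<close> strictly contains it, hence is \<open>G\<close>. So \<open>l x \<otimes> inv a\<close> always lies in \<open>N\<close>, and it
  determines \<open>x\<close> modulo \<open>N\<close>. This makes \<open>N\<close> and \<open>G / N\<close> equally large, which is where \<open>p = q\<close> comes from: the
  exponents \<open>k\<close> and \<open>m\<close> both run over the residues modulo the order of \<open>N\<close>.
\<close>

lemma nonconstant_structure:
  assumes order: "order G = p * q" and p: "prime p" and q: "prime q"
    and nonconst: "x0 \<in> carrier G" "l x0 \<noteq> l \<one>"
  obtains d where "p = q" "d \<in> carrier G" "ord d = p" "l \<one> [^] int p \<in> generate G {d}"
    and "\<And>(k :: int) (m :: int). l (l \<one> [^] k \<otimes> d [^] m) = l \<one> \<otimes> d [^] k"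
    and "bij_betw (\<lambda>(k, m). l \<one> [^] k \<otimes> d [^] m) (Zmod p \<times> Zmod p) (carrier G)"
proof -
  define a where "a = l \<one>"
  have a [simp]: "a \<in> carrier G" by (simp add: a_def)
  have triv: "subgroup {\<one>} G" by (rule triv_subgroup)
  have triv_rcos: "{\<one>} #> x = {x}" if "x \<in> carrier G" for x
    using that by (simp add: r_coset_def)
  have triv_resp: "respects_cosets {\<one>}"
    by (auto simp: respects_cosets_def triv_rcos)
  define N where "N = retract_kernel {\<one>}"
  have N: "subgroup N G" and N_resp: "respects_cosets N"
    unfolding N_def using subgroup_retract_kernel[OF triv triv_resp]
      respects_cosets_retract_kernel(2)[OF triv triv_resp] by blast+
  note NG = subgroup.subset[OF N]
  have N_iff: "l x = l y \<longleftrightarrow> N #> x = N #> y" if "x \<in> carrier G" "y \<in> carrier G" for x y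
    using rcos_retract_kernel_iff[OF triv triv_resp that] that by (simp add: N_def triv_rcos)
  have finite_sub: "finite H" if "subgroup H G" for H
    using subgroup.subset[OF that] finite_carrier by (rule finite_subset)
  have pq: "1 < p * q" using less_1_mult[OF prime_gt_1_nat[OF p] prime_gt_1_nat[OF q]] .
  have "{\<one>} \<noteq> carrier G"
  proof
    assume "{\<one>} = carrier G"
    then have "order G = card {\<one>}" unfolding order_def by (rule arg_cong[symmetric])
    then show False using pq order by simp
  qed
  then have "N \<noteq> {\<one>}"
    using retract_kernel_fixed_imp_top[OF triv triv_resp] unfolding N_def by blast
  then have N1: "card N \<noteq> 1"
    using subgroup.one_closed[OF N] by (metis card_1_singletonE singletonD)
  have NG_ne: "N \<noteq> carrier G"
  proof
    assume "N = carrier G"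
    then have "N #> x0 = N #> \<one>" using nonconst(1) N coset_join2[OF _ N] by simp
    then show False using N_iff nonconst by simp
  qed
  define M where "M = retract_kernel N"
  have M: "subgroup M G" unfolding M_def by (rule subgroup_retract_kernel[OF N N_resp])
  have "N \<subseteq> M" unfolding M_def by (rule respects_cosets_retract_kernel[OF N N_resp])
  have "N \<noteq> M" using retract_kernel_fixed_imp_top[OF N N_resp] NG_ne by (auto simp: M_def)
  have card_NM: "card N < card M"
    using \<open>N \<subseteq> M\<close> \<open>N \<noteq> M\<close> finite_sub[OF M] by (simp add: psubset_card_mono psubsetI)
  have card_NG: "card N \<noteq> p * q"
    using NG_ne NG finite_carrier order card_subset_eq unfolding order_def by metis
  have dvd_pq: "card H dvd p * q" if "subgroup H G" for H
    using lagrange[OF that] order by (metis dvd_triv_right)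
  have "card N \<in> {1, p, q, p * q}"
    using dvd_prime_prod_cases[OF p q dvd_pq[OF N]] .
  then have card_N: "card N = p \<or> card N = q" using N1 card_NG by blast
  then have prN: "prime (card N)" using p q by auto
  have "card N dvd card M"
  proof -
    interpret GM: group "G\<lparr>carrier := M\<rparr>" by (rule subgroup.subgroup_is_group[OF M group_axioms])
    have "subgroup N (G\<lparr>carrier := M\<rparr>)"
      by (rule subgroup_incl[OF N M \<open>N \<subseteq> M\<close>])
    from GM.lagrange[OF this] have "card (rcosets\<^bsub>G\<lparr>carrier := M\<rparr>\<^esub> N) * card N = card M"
      by (simp add: order_def)
    then show ?thesis by (rule dvdI[OF sym, OF trans, rotated]) (rule mult.commute)
  qed
  have "card M = p * q"
  proof -
    obtain w where w: "card M = card N * w" using \<open>card N dvd card M\<close> by blast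
    obtain v where v: "card N * v = p * q" "prime v"
      using card_N p q by (metis mult.commute)
    have "card N * w dvd card N * v" using dvd_pq[OF M] by (simp add: w v(1))
    then have "w dvd v" using prN by auto
    moreover have "w \<noteq> 1" using w card_NM by simp
    ultimately have "w = v" using v(2) by (metis prime_nat_iff)
    then show ?thesis using w v by simp
  qed
  then have M_top: "M = carrier G"
    using card_subset_eq[OF finite_carrier subgroup.subset[OF M]] order by (simp add: order_def)
  have l_coset: "N #> l x = N #> a" if "x \<in> carrier G" for x
  proof -
    have "x \<in> retract_kernel N" using that M_top by (simp add: M_def)
    then show ?thesis by (simp add: retract_kernel_def a_def)
  qed
  define d where "d = l a \<otimes> inv a"
  have in_N: "l x \<otimes> inv a \<in> N" if "x \<in> carrier G" for x
    using l_coset[OF that] subgroup.rcos_module[OF N group_axioms, of a "l x"]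
      rcos_self[OF _ N, of "l x"] that by simp
  have dN: "d \<in> N" unfolding d_def by (rule in_N) simp
  then have d [simp]: "d \<in> carrier G" using NG by blast
  have "d \<otimes> a = l a" by (simp add: d_def m_assoc)
  then have la: "l a = a \<otimes> d" by (simp add: m_comm[of a d])
  \<comment> \<open>the law at \<open>\<one>\<close> and \<open>x\<close>, where \<open>l (l x) = l a\<close> because \<open>l x\<close> and \<open>a\<close> agree modulo \<open>N\<close>\<close>
  have step: "l (x \<otimes> a) = l x \<otimes> d" if x: "x \<in> carrier G" for x
  proof -
    have "l (l x) = a \<otimes> d" using N_iff[of "l x" a] l_coset[OF x] la x by simp
    then have "a \<otimes> l (x \<otimes> a) = a \<otimes> (l x \<otimes> d)"
      using l_law[of \<one> x] x by (simp flip: a_def add: m_ac)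
    then show ?thesis using x by simp
  qed
  have nstep: "l (a [^] n) = a \<otimes> d [^] n" for n :: nat
  proof (induction n)
    case (Suc n)
    then show ?case using step[of "a [^] n"] by (simp add: m_assoc)
  qed (simp flip: a_def)
  have la_pow: "l (a [^] k) = a \<otimes> d [^] k" for k :: int
  proof -
    define n where "n = order G"
    have n: "0 < n" using pq order unfolding n_def by linarith
    \<comment> \<open>negative exponents are replaced by their residues modulo the order of \<open>G\<close>\<close>
    have *: "x [^] k = x [^] nat (k mod int n)" if "x \<in> carrier G" for x
    proof -
      have "x [^] nat (k mod int n) = x [^] (k mod int n)"
        using n by (simp flip: int_pow_int)
      then show ?thesis using int_pow_mod[OF that, of n k] ord_dvd_group_order[OF that]
        by (simp add: n_def)
    qed
    show ?thesis using nstep[of "nat (k mod int n)"] *[of a] *[of d] by simp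
  qed
  have l_aN: "l (a [^] k \<otimes> n) = a \<otimes> d [^] k" if n: "n \<in> N" for k :: int and n
  proof -
    have nG: "n \<in> carrier G" using n NG by blast
    have "N #> n \<otimes> a [^] k = N #> a [^] k"
      using coset_mult_assoc[OF NG nG, of "a [^] k"] rcos_eq_self_iff[OF N nG] n by simp
    then have "l (a [^] k \<otimes> n) = l (a [^] k)"
      using N_iff nG by (simp add: m_comm)
    then show ?thesis by (simp add: la_pow)
  qed
  have decomp: "\<exists>k::int. \<exists>n\<in>N. g = a [^] k \<otimes> n" if "g \<in> carrier G" for g
    using that
  proof (induction g rule: translation_induct)
    case one
    have "\<one> = a [^] (0::int) \<otimes> \<one>" by simp
    then show ?case using subgroup.one_closed[OF N] by blast
  next
    case (step g z)
    then obtain k :: int and n where n: "n \<in> N" "g = a [^] k \<otimes> n" by blast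
    have nG: "n \<in> carrier G" using n NG by blast
    have "g \<otimes> l z = a [^] (k + 1) \<otimes> (n \<otimes> (l z \<otimes> inv a))"
    proof -
      define w where "w = l z \<otimes> inv a"
      have w: "w \<in> carrier G" "l z = w \<otimes> a" using step(2) by (simp_all add: w_def m_assoc)
      have "g \<otimes> l z = a [^] (k + 1) \<otimes> (n \<otimes> w)"
        using nG w(1) unfolding n(2) w(2) by (simp add: int_pow_mult m_ac)
      then show ?thesis unfolding w_def .
    qed
    moreover have "n \<otimes> (l z \<otimes> inv a) \<in> N"
      using subgroup.m_closed[OF N] n in_N step by simp
    ultimately show ?case by blast
  qed
  have d1: "d \<noteq> \<one>"
  proof
    assume "d = \<one>"
    then have "l x = a" if "x \<in> carrier G" for x
      using decomp[OF that] l_aN by auto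
    then show False using nonconst by simp
  qed
  have gen_d: "generate G {d} = N" and ord_d: "ord d = card N"
    using prime_card_subgroup_generated[OF N prN dN d1] .
  have N_pos: "0 < card N" using prN prime_gt_0_nat by blast
  have pow_d: "d [^] k \<in> N" for k :: int
    using gen_d generate_pow[OF d] by blast
  have a_pow: "a [^] int (card N) \<in> N"
  proof -
    have "d [^] int (card N) = \<one>" using ord_d by (simp add: int_pow_eq_id)
    then have "l (a [^] int (card N)) = l \<one>" using la_pow by (simp flip: a_def)
    then have "N #> a [^] int (card N) = N" using N_iff[of "a [^] int (card N)" \<one>] NG by simp
    then show ?thesis using rcos_eq_self_iff[OF N] by simp
  qed
  have bij: "bij_betw (\<lambda>(k, m). a [^] k \<otimes> d [^] m) (Zmod (card N) \<times> Zmod (card N)) (carrier G)"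
  proof (rule bij_betw_imageI)
    show "inj_on (\<lambda>(k, m). a [^] k \<otimes> d [^] m) (Zmod (card N) \<times> Zmod (card N))"
    proof (rule inj_onI, clarsimp)
      fix k m k' m' :: int
      assume *: "0 \<le> k" "k < int (card N)" "0 \<le> m" "m < int (card N)"
        "0 \<le> k'" "k' < int (card N)" "0 \<le> m'" "m' < int (card N)"
      assume eq: "a [^] k \<otimes> d [^] m = a [^] k' \<otimes> d [^] m'"
      \<comment> \<open>applying \<open>l\<close> forgets the factor in \<open>N\<close> and turns the exponent of \<open>a\<close> into one of \<open>d\<close>\<close>
      then have "a \<otimes> d [^] k = a \<otimes> d [^] k'"
        using l_aN[OF pow_d] by metis
      then have "k = k'" using Zmod_cong_imp_eq[of k "card N" k'] * ord_d by (simp add: int_pow_eq)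
      moreover from this have "m = m'"
        using Zmod_cong_imp_eq[of m "card N" m'] eq * ord_d by (simp add: int_pow_eq)
      ultimately show "k = k' \<and> m = m'" ..
    qed
    show "(\<lambda>(k, m). a [^] k \<otimes> d [^] m) ` (Zmod (card N) \<times> Zmod (card N)) = carrier G"
    proof (intro equalityI subsetI)
      fix g assume "g \<in> carrier G"
      then obtain k :: int and n where n: "n \<in> N" "g = a [^] k \<otimes> n" using decomp by blast
      define c where "c = int (card N)"
      have aq: "(a [^] c) [^] (k div c) \<in> N"
        using subgroup_int_pow_closed[OF N a_pow] by (simp add: c_def)
      have nG: "n \<in> carrier G" using n NG by blast
      have "a [^] k = a [^] (k mod c + c * (k div c))" by simp
      also have "\<dots> = a [^] (k mod c) \<otimes> (a [^] c) [^] (k div c)"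
        using int_pow_mult[OF a, of "k mod c" "c * (k div c)"] int_pow_pow[OF a, of c "k div c"]
        by (simp only:)
      finally have "g = a [^] (k mod c) \<otimes> ((a [^] c) [^] (k div c) \<otimes> n)"
        using n nG by (simp add: m_assoc)
      moreover obtain m where "m \<in> Zmod (card N)" "(a [^] c) [^] (k div c) \<otimes> n = d [^] m"
        using generate_subset_Zmod_pow[OF d, of "(a [^] c) [^] (k div c) \<otimes> n"] gen_d ord_d N_pos
          subgroup.m_closed[OF N aq n(1)] by metis
      moreover have "k mod c \<in> Zmod (card N)" using N_pos by (simp add: c_def)
      ultimately show "g \<in> (\<lambda>(k, m). a [^] k \<otimes> d [^] m) ` (Zmod (card N) \<times> Zmod (card N))"
        by force
    qed auto
  qed
  have "card N * card N = p * q"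
    using bij_betw_same_card[OF bij] order by (simp add: order_def card_cartesian_product)
  then have pq_eq: "p = q" "card N = p" using card_N prN by auto
  show thesis
    by (rule that[OF pq_eq(1) d])
      (use ord_d a_pow gen_d l_aN[OF pow_d] bij pq_eq(2) in \<open>simp_all add: a_def\<close>)
qed

end

section \<open>Affine shifts\<close>

text \<open>
  The common form of the shift (\<open>c = 0\<close>) and of the twisted shifts (\<open>n = p\<^sup>2\<close> and \<open>c = p t\<close>).
\<close>

definition affine_shift_op :: "nat \<Rightarrow> int \<Rightarrow> int \<Rightarrow> int \<Rightarrow> int" where
  "affine_shift_op n c i j = (j + 1 + c * i) mod int n"

lemma shift_op_eq_affine: "shift_op n = affine_shift_op n 0"
  by (intro ext) (simp add: shift_op_def affine_shift_op_def)

definition linear_map :: "nat \<Rightarrow> int \<Rightarrow> int \<Rightarrow> int" where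
  "linear_map p t = (\<lambda>l\<in>Zmod p. (l * t) mod int p)"

lemma linear_maps_eq_image: "linear_maps p = linear_map p ` {1..<int p}"
proof -
  have "{1..<int p} = {t \<in> Zmod p. t \<noteq> 0}" by auto
  then show ?thesis unfolding linear_maps_def linear_map_def by blast
qed

lemma twisted_shift_op_eq_affine:
  assumes "0 < p"
  shows "twisted_shift_op p (linear_map p t) = affine_shift_op (p\<^sup>2) (int p * t)"
proof (intro ext)
  fix i j
  have "linear_map p t (i mod int p) = (t * i) mod int p"
    using assms by (simp add: linear_map_def mod_mult_right_eq mult.commute)
  then have "int p * linear_map p t (i mod int p) = (int p * t * i) mod int (p\<^sup>2)"
    using mult_mod_right[of "int p" "t * i" "int p"]
    by (simp only: power2_eq_square mult.assoc of_nat_mult)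
  then show "twisted_shift_op p (linear_map p t) i j = affine_shift_op (p\<^sup>2) (int p * t) i j"
    unfolding twisted_shift_op_def affine_shift_op_def by (simp only: mod_add_right_eq)
qed

lemma linear_map_inj: "1 < p \<Longrightarrow> inj_on (linear_map p) {1..<int p}"
proof (rule inj_onI)
  fix s t assume *: "1 < p" "s \<in> {1..<int p}" "t \<in> {1..<int p}" "linear_map p s = linear_map p t"
  have "linear_map p s 1 = linear_map p t 1" by (simp only: *(4))
  then show "s = t" using *(1-3) by (simp add: linear_map_def)
qed

text \<open>
  For \<open>l i = 1 + c i\<close> on \<open>\<int>/n\<close>, the two sides of the translation law differ by \<open>c\<^sup>2 (x - y)\<close>, and \<open>l 0 = 1\<close>
  is a generator.
\<close>

lemma affine_shift_properties:
  assumes n: "0 < n" and c: "int n dvd c * c"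
  shows "indecomposable_abelian n (Zmod n) (affine_shift_op n c)"
    and "permutation_group (Zmod n) (affine_shift_op n c) \<cong> integer_mod_group n"
proof -
  define G where "G = integer_mod_group n"
  define l where "l = (\<lambda>i. (1 + c * i) mod int n)"
  have carrier: "carrier G = Zmod n" using n by (simp add: G_def carrier_integer_mod_group)
  have mult: "x \<otimes>\<^bsub>G\<^esub> y = (x + y) mod int n" for x y by (simp add: G_def)
  have G: "comm_group G" by (simp add: G_def)
  interpret G: comm_group G by (rule G)
  interpret abelian_translation_cycle_set G l
  proof
    show "finite (carrier G)" by (simp add: carrier)
    show l_closed: "l x \<in> carrier G" for x using n by (simp add: carrier l_def)
    show "generate G (l ` carrier G) = carrier G"
    proof
      show "generate G (l ` carrier G) \<subseteq> carrier G" using l_closed by (intro G.generate_incl) blast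
      show "carrier G \<subseteq> generate G (l ` carrier G)"
      proof
        fix k assume k: "k \<in> carrier G"
        have "l 0 \<in> generate G (l ` carrier G)"
          by (intro generate.incl imageI) (simp add: carrier n)
        moreover have "subgroup (generate G (l ` carrier G)) G"
          using l_closed by (intro G.generate_is_subgroup) blast
        ultimately have "l 0 [^]\<^bsub>G\<^esub> k \<in> generate G (l ` carrier G)"
          by (intro G.subgroup_int_pow_closed)
        moreover have "l 0 [^]\<^bsub>G\<^esub> k = k"
          using k mod_mult_right_eq[of k 1 "int n"]
          unfolding carrier unfolding G_def int_pow_integer_mod_group l_def by simp
        ultimately show "k \<in> generate G (l ` carrier G)" by simp
      qed
    qed
    fix x y assume "x \<in> carrier G" "y \<in> carrier G"
    have "(1 + c * x) + (1 + c * (y + (1 + c * x))) - ((1 + c * y) + (1 + c * (x + (1 + c * y))))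
        = c * c * (x - y)"
      by (simp add: algebra_simps)
    then have "((1 + c * x) + (1 + c * (y + (1 + c * x)))) mod int n =
        ((1 + c * y) + (1 + c * (x + (1 + c * y)))) mod int n"
      using c by (simp add: mod_eq_dvd_iff)
    moreover have "l x \<otimes>\<^bsub>G\<^esub> l (y \<otimes>\<^bsub>G\<^esub> l x) =
        ((1 + c * x) + (1 + c * (y + (1 + c * x)))) mod int n" for x y
    proof -
      have "l (y \<otimes>\<^bsub>G\<^esub> l x) = (1 + c * (y + (1 + c * x))) mod int n"
        unfolding l_def mult by (metis mod_add_right_eq mod_mult_right_eq)
      then show ?thesis unfolding mult by (simp add: l_def mod_add_eq)
    qed
    ultimately show "l x \<otimes>\<^bsub>G\<^esub> l (y \<otimes>\<^bsub>G\<^esub> l x) = l y \<otimes>\<^bsub>G\<^esub> l (x \<otimes>\<^bsub>G\<^esub> l y)"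
      by simp
  qed
  have "affine_shift_op n c x y = l x \<otimes>\<^bsub>G\<^esub> y" for x y
    unfolding mult affine_shift_op_def l_def by (simp add: mod_simps algebra_simps)
  then have "indecomposable_abelian (order G) (carrier G) (affine_shift_op n c)"
    "permutation_group (carrier G) (affine_shift_op n c) \<cong> G"
    using translation_cycle_set_properties by blast+
  then show "indecomposable_abelian n (Zmod n) (affine_shift_op n c)"
    "permutation_group (Zmod n) (affine_shift_op n c) \<cong> integer_mod_group n"
    by (simp_all add: carrier order_def flip: G_def)
qed

section \<open>The family on the product of two cyclic groups\<close>

text \<open>
  Here \<open>l (i, s) = (1, i)\<close>, whose values \<open>(1, 0)\<close> and \<open>(1, 1)\<close> already generate the group.
\<close>

lemma prod_op_properties:
  assumes p: "1 < p"
  shows "indecomposable_abelian (p * p) (Zmod p \<times> Zmod p) (prod_op p)"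
    and "permutation_group (Zmod p \<times> Zmod p) (prod_op p) \<cong> integer_mod_group p \<times>\<times> integer_mod_group p"
proof -
  define Z where "Z = integer_mod_group p"
  define G where "G = Z \<times>\<times> Z"
  define l :: "int \<times> int \<Rightarrow> int \<times> int" where "l = (\<lambda>(i, s). (1, i))"
  have carrier: "carrier G = Zmod p \<times> Zmod p"
    using p by (simp add: G_def Z_def carrier_integer_mod_group)
  have mult: "(i, s) \<otimes>\<^bsub>G\<^esub> (j, t) = ((i + j) mod int p, (s + t) mod int p)" for i j s t
    by (simp add: G_def Z_def)
  have Zg: "group Z" by (simp add: Z_def)
  have "group G" unfolding G_def by (rule DirProd_group[OF Zg Zg])
  then have "comm_group G"
    by (rule group.group_comm_groupI) (auto simp: G_def Z_def add.commute)
  then interpret G: comm_group G .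
  have nat_pow: "(i, s) [^]\<^bsub>G\<^esub> n = ((int n * i) mod int p, (int n * s) mod int p)" for i s and n :: nat
    by (induction n) (auto simp: mult G_def Z_def algebra_simps mod_add_left_eq mod_add_right_eq)
  interpret abelian_translation_cycle_set G l
  proof
    show "finite (carrier G)" by (simp add: carrier)
    show l_closed: "l x \<in> carrier G" if "x \<in> carrier G" for x
      using that p by (auto simp: carrier l_def)
    show "generate G (l ` carrier G) = carrier G"
    proof
      show "generate G (l ` carrier G) \<subseteq> carrier G" using l_closed by (intro G.generate_incl) blast
      show "carrier G \<subseteq> generate G (l ` carrier G)"
      proof
        fix x assume "x \<in> carrier G"
        then obtain k m where x: "x = (k, m)" "0 \<le> k" "k < int p" "0 \<le> m" "m < int p"
          by (auto simp: carrier)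
        have sub: "subgroup (generate G (l ` carrier G)) G"
          using l_closed by (intro G.generate_is_subgroup) blast
        \<comment> \<open>\<open>(k, m) = m (1, 1) + (k - m) (1, 0)\<close>; adding \<open>p\<close> makes the second coefficient a natural number\<close>
        have "(1, u) \<in> generate G (l ` carrier G)" if "u \<in> {0, 1}" for u
          using that p by (intro generate.incl image_eqI[of _ _ "(u, 0)"]) (auto simp: l_def carrier)
        then have "(1, 1) [^]\<^bsub>G\<^esub> nat m \<otimes>\<^bsub>G\<^esub> (1, 0) [^]\<^bsub>G\<^esub> nat (k - m + int p)
            \<in> generate G (l ` carrier G)"
          unfolding int_pow_int[symmetric]
          by (intro subgroup.m_closed[OF sub] G.subgroup_int_pow_closed[OF sub]) simp_all
        moreover have "(1, 1) [^]\<^bsub>G\<^esub> nat m \<otimes>\<^bsub>G\<^esub> (1, 0) [^]\<^bsub>G\<^esub> nat (k - m + int p) = x"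
          using x by (simp add: nat_pow mult mod_add_right_eq)
        ultimately show "x \<in> generate G (l ` carrier G)" by simp
      qed
    qed
    fix x y assume "x \<in> carrier G" "y \<in> carrier G"
    then show "l x \<otimes>\<^bsub>G\<^esub> l (y \<otimes>\<^bsub>G\<^esub> l x) = l y \<otimes>\<^bsub>G\<^esub> l (x \<otimes>\<^bsub>G\<^esub> l y)"
      by (cases x; cases y) (simp add: l_def mult mod_add_right_eq algebra_simps)
  qed
  have "prod_op p x y = l x \<otimes>\<^bsub>G\<^esub> y" for x y
    by (cases x; cases y) (simp add: l_def mult prod_op_def add.commute)
  then have "indecomposable_abelian (order G) (carrier G) (prod_op p)"
    "permutation_group (carrier G) (prod_op p) \<cong> G"
    using translation_cycle_set_properties by blast+
  then show "indecomposable_abelian (p * p) (Zmod p \<times> Zmod p) (prod_op p)"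
    "permutation_group (Zmod p \<times> Zmod p) (prod_op p) \<cong> integer_mod_group p \<times>\<times> integer_mod_group p"
    unfolding order_def carrier card_cartesian_product
    by (simp_all add: G_def Z_def)
qed

section \<open>Non-isomorphic families\<close>

text \<open>
  An isomorphism intertwines the left multiplications by \<open>0\<close> and by its image of \<open>0\<close>, which are translations
  by \<open>1\<close> and by some \<open>u\<close> congruent to \<open>1\<close> modulo \<open>p\<close>, so it is affine with slope \<open>u\<close>. Comparing the left
  multiplications by \<open>1\<close> and by its image then gives \<open>p s = p t\<close> modulo \<open>p\<^sup>2\<close>. The value \<open>s = 0\<close> covers the plain
  shift.
\<close>

lemma affine_shift_isomorphic_imp_eq:
  assumes p: "0 < p" and s: "s \<in> Zmod p" and t: "t \<in> Zmod p"
    and iso: "cycle_set_isomorphic (Zmod (p\<^sup>2)) (affine_shift_op (p\<^sup>2) (int p * s))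
                (Zmod (p\<^sup>2)) (affine_shift_op (p\<^sup>2) (int p * t))"
  shows "s = t"
proof -
  define N where "N = p\<^sup>2"
  have N0: "0 < N" using p by (simp add: N_def)
  obtain \<phi> where bij: "bij_betw \<phi> (Zmod N) (Zmod N)"
    and hom: "\<And>i j. i \<in> Zmod N \<Longrightarrow> j \<in> Zmod N \<Longrightarrow> \<phi> (affine_shift_op N (int p * s) i j) =
        affine_shift_op N (int p * t) (\<phi> i) (\<phi> j)"
    using iso unfolding cycle_set_isomorphic_def N_def by blast
  define u where "u = 1 + int p * t * \<phi> 0"
  have \<phi>_nat: "\<phi> (int n mod int N) = (\<phi> 0 + u * int n) mod int N" for n
  proof (induction n)
    case 0
    have "\<phi> 0 \<in> Zmod N" using bij_betwE[OF bij] N0 by simp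
    then show ?case by simp
  next
    case (Suc n)
    have "\<phi> (int (Suc n) mod int N) = \<phi> (affine_shift_op N (int p * s) 0 (int n mod int N))"
      unfolding affine_shift_op_def by (simp add: mod_add_left_eq[of "int n" "int N" 1] add.commute[of 1])
    also have "\<dots> = affine_shift_op N (int p * t) (\<phi> 0) (\<phi> (int n mod int N))"
      using N0 by (intro hom) auto
    also have "\<dots> = ((\<phi> 0 + u * int n) mod int N + u) mod int N"
      by (simp add: Suc affine_shift_op_def u_def add.assoc)
    also have "\<dots> = (\<phi> 0 + u * int (Suc n)) mod int N"
      by (simp add: mod_simps algebra_simps)
    finally show ?case .
  qed
  have \<phi>_int: "\<phi> (k mod int N) = (\<phi> 0 + u * k) mod int N" if "0 \<le> k" for k
    using \<phi>_nat[of "nat k"] that by simp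
  have s0: "0 \<le> s" using s by simp
  have "\<phi> ((1 + int p * s) mod int N) = \<phi> (affine_shift_op N (int p * s) (1 mod int N) 0)"
    by (simp add: affine_shift_op_def mod_add_right_eq mod_mult_right_eq)
      (metis mod_add_right_eq mod_mult_right_eq mult.right_neutral)
  also have "\<dots> = affine_shift_op N (int p * t) (\<phi> (1 mod int N)) (\<phi> 0)"
    using N0 by (intro hom) auto
  also have "\<dots> = (\<phi> 0 + 1 + int p * t * (\<phi> 0 + u)) mod int N"
  proof -
    have "\<phi> (1 mod int N) = (\<phi> 0 + u) mod int N" using \<phi>_int[of 1] by simp
    then show ?thesis
      unfolding affine_shift_op_def
      by (simp only: mod_add_cong[OF refl mod_mult_right_eq[of "int p * t" "\<phi> 0 + u"]])
  qed
  finally have "(\<phi> 0 + u * (1 + int p * s)) mod int N = (\<phi> 0 + 1 + int p * t * (\<phi> 0 + u)) mod int N"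
    using \<phi>_int[of "1 + int p * s"] s0 by simp
  then have "int N dvd (\<phi> 0 + u * (1 + int p * s)) - (\<phi> 0 + 1 + int p * t * (\<phi> 0 + u))"
    by (simp add: mod_eq_dvd_iff)
  also have "(\<phi> 0 + u * (1 + int p * s)) - (\<phi> 0 + 1 + int p * t * (\<phi> 0 + u))
      = int p * (s - t) + int N * (t * \<phi> 0 * (s - t))"
    by (simp add: u_def N_def power2_eq_square algebra_simps)
  finally have "int N dvd int p * (s - t)"
    using dvd_diff[OF _ dvd_triv_left[of "int N" "t * \<phi> 0 * (s - t)"]] by fastforce
  then have "int p * int p dvd int p * (s - t)" by (simp add: N_def power2_eq_square)
  then have "int p dvd s - t" using p by simp
  then show ?thesis using Zmod_cong_imp_eq[OF t s] by simp
qed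

text \<open>
  The left multiplications of the product family have order \<open>p\<close>, whereas the left multiplication by \<open>0\<close> in
  an affine shift is the translation by \<open>1\<close>, of order \<open>p\<^sup>2\<close>.
\<close>

lemma affine_shift_not_isomorphic_prod:
  assumes p: "1 < p"
  shows "\<not> cycle_set_isomorphic (Zmod (p\<^sup>2)) (affine_shift_op (p\<^sup>2) c) (Zmod p \<times> Zmod p) (prod_op p)"
proof
  define N where "N = p\<^sup>2"
  have N: "p < N" using p by (simp add: N_def power2_eq_square)
  assume "cycle_set_isomorphic (Zmod (p\<^sup>2)) (affine_shift_op (p\<^sup>2) c) (Zmod p \<times> Zmod p) (prod_op p)"
  then obtain \<phi> where bij: "bij_betw \<phi> (Zmod N) (Zmod p \<times> Zmod p)"
    and hom: "\<And>i j. i \<in> Zmod N \<Longrightarrow> j \<in> Zmod N \<Longrightarrow>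
        \<phi> (affine_shift_op N c i j) = prod_op p (\<phi> i) (\<phi> j)"
    unfolding cycle_set_isomorphic_def N_def by blast
  obtain j t where jt: "\<phi> 0 = (j, t)" by (metis surj_pair)
  have jt_Z: "j \<in> Zmod p" "t \<in> Zmod p" using bij_betwE[OF bij] jt N by force+
  have "\<phi> (int n) = ((j + int n) mod int p, (t + int n * j) mod int p)" if "n < N" for n
    using that
  proof (induction n)
    case 0
    then show ?case using jt jt_Z by simp
  next
    case (Suc n)
    have "\<phi> (int (Suc n)) = \<phi> (affine_shift_op N c 0 (int n))"
      using Suc.prems by (simp add: affine_shift_op_def add.commute)
    also have "\<dots> = prod_op p (j, t) (\<phi> (int n))"
      using Suc.prems jt by (subst hom) auto
    also have "\<dots> = ((j + int (Suc n)) mod int p, (t + int (Suc n) * j) mod int p)"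
      using Suc by (simp add: prod_op_def mod_simps algebra_simps)
    finally show ?case .
  qed
  from this[OF N] have "\<phi> (int p) = \<phi> 0" using jt jt_Z by simp
  then have "int p = 0" using bij_betw_imp_inj_on[OF bij] N by (auto dest: inj_onD)
  then show False using p by simp
qed

section \<open>Classification\<close>

context abelian_translation_cycle_set
begin

text \<open>
  The isomorphism is the inverse of \<open>k \<mapsto> a\<^sup>k\<close>: the map out of \<open>\<int>/n\<close> has a formula, the discrete
  logarithm does not.
\<close>

lemma cyclic_imp_affine_shift:
  assumes a: "a \<in> carrier G" "ord a = order G"
    and l: "\<And>k :: int. l (a [^] k) = a [^] (1 + c * k)"
  shows "cycle_set_isomorphic (carrier G) (\<lambda>x y. l x \<otimes> y)
           (Zmod (order G)) (affine_shift_op (order G) c)"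
proof (rule cycle_set_isomorphic_sym)
  have pos: "0 < order G" using finite_carrier by (simp add: order_gt_0_iff_finite)
  have "generate G {a} = carrier G"
  proof (rule card_subset_eq[OF finite_carrier])
    show "generate G {a} \<subseteq> carrier G" using generate_incl[of "{a}"] a(1) by simp
    show "card (generate G {a}) = card (carrier G)"
      using generate_pow_card[OF a(1)] a(2) by (simp add: order_def)
  qed
  then have bij: "bij_betw (\<lambda>k. a [^] k) (Zmod (order G)) (carrier G)"
    using bij_betw_Zmod_pow[OF a(1)] a(2) pos by simp
  have "a [^] affine_shift_op (order G) c i j = l (a [^] i) \<otimes> a [^] j" for i j
  proof -
    have "a [^] affine_shift_op (order G) c i j = a [^] ((1 + c * i) + j)"
      unfolding affine_shift_op_def using int_pow_mod[OF a(1), of "order G"] a(2)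
      by (simp add: algebra_simps)
    then show ?thesis using int_pow_mult[OF a(1)] l by simp
  qed
  then show "cycle_set_isomorphic (Zmod (order G)) (affine_shift_op (order G) c)
      (carrier G) (\<lambda>x y. l x \<otimes> y)"
    unfolding cycle_set_isomorphic_def using bij by blast
  show "affine_shift_op (order G) c x y \<in> Zmod (order G)" for x y
    using pos by (simp add: affine_shift_op_def)
qed

lemma constant_imp_shift:
  assumes "\<And>x. x \<in> carrier G \<Longrightarrow> l x = l \<one>"
  shows "cycle_set_isomorphic (carrier G) (\<lambda>x y. l x \<otimes> y) (Zmod (order G)) (shift_op (order G))"
proof -
  have "l ` carrier G = {l \<one>}" using assms one_closed by blast
  then have "ord (l \<one>) = order G"
    using l_generates generate_pow_card[of "l \<one>"] by (simp add: order_def)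
  moreover have "l (l \<one> [^] k) = l \<one> [^] (1 + 0 * k)" for k :: int
    using assms[of "l \<one> [^] k"] by simp
  ultimately show ?thesis
    unfolding shift_op_eq_affine by (intro cyclic_imp_affine_shift[of "l \<one>"]) simp_all
qed

text \<open>
  With \<open>a = l \<one>\<close>, the two non-constant families are separated by whether \<open>a\<^sup>p\<close>, which lies in the subgroup
  generated by \<open>d\<close>, is trivial. If it is not, it generates that subgroup, so \<open>d\<close> is a power of \<open>a\<close> and \<open>a\<close>
  generates \<open>G\<close>.
\<close>

theorem prime_prod_order_classification:
  assumes order: "order G = p * q" and p: "prime p" and q: "prime q"
  shows "cycle_set_isomorphic (carrier G) (\<lambda>x y. l x \<otimes> y) (Zmod (p * q)) (shift_op (p * q)) \<or>
    p = q \<and>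
     ((\<exists>f\<in>linear_maps p.
         cycle_set_isomorphic (carrier G) (\<lambda>x y. l x \<otimes> y) (Zmod (p\<^sup>2)) (twisted_shift_op p f)) \<or>
      cycle_set_isomorphic (carrier G) (\<lambda>x y. l x \<otimes> y) (Zmod p \<times> Zmod p) (prod_op p))"
proof (cases "\<forall>x\<in>carrier G. l x = l \<one>")
  case True
  then have "cycle_set_isomorphic (carrier G) (\<lambda>x y. l x \<otimes> y) (Zmod (order G)) (shift_op (order G))"
    by (intro constant_imp_shift) blast
  then show ?thesis unfolding order ..
next
  case False
  then obtain x0 where x0: "x0 \<in> carrier G" "l x0 \<noteq> l \<one>" by blast
  obtain d where pq: "p = q" and d: "d \<in> carrier G" "ord d = p"
    and pow_N: "l \<one> [^] int p \<in> generate G {d}"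
    and l: "\<And>(k :: int) (m :: int). l (l \<one> [^] k \<otimes> d [^] m) = l \<one> \<otimes> d [^] k"
    and bij: "bij_betw (\<lambda>(k, m). l \<one> [^] k \<otimes> d [^] m) (Zmod p \<times> Zmod p) (carrier G)"
    using nonconstant_structure[OF order p q x0] by blast
  define a where "a = l \<one>"
  have a: "a \<in> carrier G" by (simp add: a_def)
  have p0: "0 < p" and p1: "1 < p" using prime_gt_0_nat[OF p] prime_gt_1_nat[OF p] .
  have l_pow: "l (a [^] k) = a \<otimes> d [^] k" for k :: int
    using l[of k 0] a d(1) by (simp add: a_def)
  show ?thesis
  proof (cases "a [^] int p = \<one>")
    case True
    then have "ord a dvd p" using a by (simp add: int_pow_eq_id)
    \<comment> \<open>\<open>G\<close> is the direct product of the subgroups generated by \<open>a\<close> and \<open>d\<close>\<close>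
    have "cycle_set_isomorphic (Zmod p \<times> Zmod p) (prod_op p) (carrier G) (\<lambda>x y. l x \<otimes> y)"
      unfolding cycle_set_isomorphic_def
    proof (intro exI conjI ballI)
      show "bij_betw (\<lambda>(k, m). a [^] k \<otimes> d [^] m) (Zmod p \<times> Zmod p) (carrier G)"
        using bij by (simp add: a_def)
      fix x y :: "int \<times> int"
      obtain i s j t where xy: "x = (i, s)" "y = (j, t)" by (metis surj_pair)
      have "a [^] (j + 1) \<otimes> d [^] (t + i) = (a \<otimes> d [^] i) \<otimes> (a [^] j \<otimes> d [^] t)"
        using a d(1) by (simp add: int_pow_mult m_ac)
      then show "(case prod_op p x y of (k, m) \<Rightarrow> a [^] k \<otimes> d [^] m) =
          l (case x of (k, m) \<Rightarrow> a [^] k \<otimes> d [^] m) \<otimes> (case y of (k, m) \<Rightarrow> a [^] k \<otimes> d [^] m)"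
        using l[of i s] int_pow_mod[OF a \<open>ord a dvd p\<close>] int_pow_mod[OF d(1), of p] d(2)
        by (simp add: xy prod_op_def a_def)
    qed
    then have "cycle_set_isomorphic (carrier G) (\<lambda>x y. l x \<otimes> y) (Zmod p \<times> Zmod p) (prod_op p)"
      by (rule cycle_set_isomorphic_sym) (auto simp: prod_op_def p0)
    then show ?thesis using pq by blast
  next
    case False
    define N where "N = generate G {d}"
    have N: "subgroup N G" unfolding N_def using generate_is_subgroup[of "{d}"] d(1) by simp
    have card_N: "card N = p" using generate_pow_card[OF d(1)] d(2) by (simp add: N_def)
    have pow_N': "a [^] int p \<in> N" using pow_N by (simp add: N_def a_def)
    note gen = prime_card_subgroup_generated[OF N _ pow_N' False, unfolded card_N, OF p]
    have dN: "d \<in> N" unfolding N_def by (rule generate.incl) simp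
    obtain t where t: "t \<in> Zmod p" "d = (a [^] int p) [^] t"
      using generate_subset_Zmod_pow[of "a [^] int p" d] gen dN a p0 by auto
    have "d \<noteq> \<one>" using d(2) p1 by auto
    then have "t \<noteq> 0" using t(2) by auto
    have d_pow: "d [^] k = a [^] (int p * t * k)" for k :: int
      using t(2) a by (simp add: int_pow_pow)
    have "ord a dvd p * p" using ord_dvd_group_order[OF a] order pq by simp
    then have "ord a \<in> {1, p, p * p}" using dvd_prime_prod_cases[OF p p] by auto
    moreover have "\<not> ord a dvd p" using False a by (simp add: int_pow_eq_id)
    ultimately have ord_a: "ord a = order G" using order pq by auto
    have "cycle_set_isomorphic (carrier G) (\<lambda>x y. l x \<otimes> y)
        (Zmod (order G)) (affine_shift_op (order G) (int p * t))"
      by (rule cyclic_imp_affine_shift[OF a ord_a])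
        (use a in \<open>simp add: l_pow d_pow int_pow_mult\<close>)
    moreover have "order G = p\<^sup>2" by (simp add: order pq power2_eq_square)
    ultimately have "cycle_set_isomorphic (carrier G) (\<lambda>x y. l x \<otimes> y)
        (Zmod (p\<^sup>2)) (twisted_shift_op p (linear_map p t))"
      by (simp only: twisted_shift_op_eq_affine[OF p0])
    moreover have "linear_map p t \<in> linear_maps p"
      using t(1) \<open>t \<noteq> 0\<close> by (auto simp: linear_maps_eq_image)
    ultimately show ?thesis using pq by blast
  qed
qed

end

theorem indecomposable_abelian_prime_prod_cases:
  assumes p: "prime p" and q: "prime q" and S: "indecomposable_abelian (p * q) S opr"
  shows "cycle_set_isomorphic S opr (Zmod (p * q)) (shift_op (p * q)) \<or>
    p = q \<and>
     ((\<exists>f\<in>linear_maps p. cycle_set_isomorphic S opr (Zmod (p\<^sup>2)) (twisted_shift_op p f)) \<or>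
      cycle_set_isomorphic S opr (Zmod p \<times> Zmod p) (prod_op p))"
proof -
  define G where "G = permutation_group S opr"
  have "0 < p * q" using p q by (simp add: prime_gt_0_nat)
  then obtain l where l: "abelian_translation_cycle_set G l" and order: "order G = p * q"
    and iso: "cycle_set_isomorphic (carrier G) (\<lambda>x y. l x \<otimes>\<^bsub>G\<^esub> y) S opr"
    using indecomposable_abelian_translation_model[OF S] unfolding G_def by blast
  interpret abelian_translation_cycle_set G l by (rule l)
  have "cycle_set_isomorphic S opr (carrier G) (\<lambda>x y. l x \<otimes>\<^bsub>G\<^esub> y)"
    using iso by (rule cycle_set_isomorphic_sym) simp
  note to_model = cycle_set_isomorphic_trans[OF this]
  show ?thesis
    using prime_prod_order_classification[OF order p q] by (auto intro: to_model)
qed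

theorem theorem19:
  fixes p q :: nat
  assumes "prime p" and "prime q"
  shows
    "(p \<noteq> q \<longrightarrow>
        indecomposable_abelian (p * q) (Zmod (p * q)) (shift_op (p * q)) \<and>
        permutation_group (Zmod (p * q)) (shift_op (p * q)) \<cong> integer_mod_group (p * q) \<and>
        (\<forall>(S :: 'a set) opr. indecomposable_abelian (p * q) S opr \<longrightarrow>
           cycle_set_isomorphic S opr (Zmod (p * q)) (shift_op (p * q))))
   \<and> (p = q \<longrightarrow>
        \<comment> \<open>the three families consist of cycle sets of the required kind\<close>
        (indecomposable_abelian (p * q) (Zmod (p\<^sup>2)) (shift_op (p\<^sup>2)) \<and>
         permutation_group (Zmod (p\<^sup>2)) (shift_op (p\<^sup>2)) \<cong> integer_mod_group (p\<^sup>2)) \<and>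
        (\<forall>f\<in>linear_maps p.
           indecomposable_abelian (p * q) (Zmod (p\<^sup>2)) (twisted_shift_op p f) \<and>
           permutation_group (Zmod (p\<^sup>2)) (twisted_shift_op p f) \<cong> integer_mod_group (p\<^sup>2)) \<and>
        (indecomposable_abelian (p * q) (Zmod p \<times> Zmod p) (prod_op p) \<and>
         permutation_group (Zmod p \<times> Zmod p) (prod_op p)
           \<cong> integer_mod_group p \<times>\<times> integer_mod_group p) \<and>
        \<comment> \<open>they exhaust all such cycle sets\<close>
        (\<forall>(S :: 'a set) opr. indecomposable_abelian (p * q) S opr \<longrightarrow>
           cycle_set_isomorphic S opr (Zmod (p\<^sup>2)) (shift_op (p\<^sup>2)) \<or>
           (\<exists>f\<in>linear_maps p.
              cycle_set_isomorphic S opr (Zmod (p\<^sup>2)) (twisted_shift_op p f)) \<or>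
           cycle_set_isomorphic S opr (Zmod p \<times> Zmod p) (prod_op p)) \<and>
        \<comment> \<open>the second family consists of \<open>p - 1\<close> pairwise non-isomorphic cycle sets\<close>
        card (linear_maps p) = p - 1 \<and>
        (\<forall>f\<in>linear_maps p. \<forall>g\<in>linear_maps p. f \<noteq> g \<longrightarrow>
           \<not> cycle_set_isomorphic (Zmod (p\<^sup>2)) (twisted_shift_op p f)
                (Zmod (p\<^sup>2)) (twisted_shift_op p g)) \<and>
        \<comment> \<open>cycle sets from different families are not isomorphic\<close>
        (\<forall>f\<in>linear_maps p.
           \<not> cycle_set_isomorphic (Zmod (p\<^sup>2)) (shift_op (p\<^sup>2))
                (Zmod (p\<^sup>2)) (twisted_shift_op p f) \<and>
           \<not> cycle_set_isomorphic (Zmod (p\<^sup>2)) (twisted_shift_op p f)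
                (Zmod p \<times> Zmod p) (prod_op p)) \<and>
        \<not> cycle_set_isomorphic (Zmod (p\<^sup>2)) (shift_op (p\<^sup>2))
             (Zmod p \<times> Zmod p) (prod_op p))"
proof (intro conjI impI)
  have p1: "1 < p" using assms(1) by (rule prime_gt_1_nat)
  then have p0: "0 < p" by simp
  have pq0: "0 < p * q" using assms by (simp add: prime_gt_0_nat)
  have pp0: "0 < p\<^sup>2" using p0 by simp
  have twist_dvd: "int (p\<^sup>2) dvd (int p * t) * (int p * t)" for t
    by (simp add: power2_eq_square mult_ac)
  have zero_twist: "shift_op (p\<^sup>2) = affine_shift_op (p\<^sup>2) (int p * 0)"
    by (simp add: shift_op_eq_affine)
  note twist = twisted_shift_op_eq_affine[OF p0]
  show "indecomposable_abelian (p * q) (Zmod (p * q)) (shift_op (p * q))"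
    "permutation_group (Zmod (p * q)) (shift_op (p * q)) \<cong> integer_mod_group (p * q)"
    using affine_shift_properties[OF pq0, of 0] by (simp_all add: shift_op_eq_affine)
  show "\<forall>(S :: 'a set) opr. indecomposable_abelian (p * q) S opr \<longrightarrow>
      cycle_set_isomorphic S opr (Zmod (p * q)) (shift_op (p * q))" if "p \<noteq> q"
    using indecomposable_abelian_prime_prod_cases[OF assms] that by blast
  show "card (linear_maps p) = p - 1"
    unfolding linear_maps_eq_image card_image[OF linear_map_inj[OF p1]] by simp
  show "\<not> cycle_set_isomorphic (Zmod (p\<^sup>2)) (shift_op (p\<^sup>2)) (Zmod p \<times> Zmod p) (prod_op p)"
    unfolding zero_twist by (rule affine_shift_not_isomorphic_prod[OF p1])
  show "\<forall>f\<in>linear_maps p.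
       \<not> cycle_set_isomorphic (Zmod (p\<^sup>2)) (shift_op (p\<^sup>2)) (Zmod (p\<^sup>2)) (twisted_shift_op p f) \<and>
       \<not> cycle_set_isomorphic (Zmod (p\<^sup>2)) (twisted_shift_op p f) (Zmod p \<times> Zmod p) (prod_op p)"
  proof
    fix f assume "f \<in> linear_maps p"
    then obtain t where t: "t \<in> {1..<int p}" "f = linear_map p t"
      unfolding linear_maps_eq_image by blast
    then show "\<not> cycle_set_isomorphic (Zmod (p\<^sup>2)) (shift_op (p\<^sup>2)) (Zmod (p\<^sup>2)) (twisted_shift_op p f) \<and>
       \<not> cycle_set_isomorphic (Zmod (p\<^sup>2)) (twisted_shift_op p f) (Zmod p \<times> Zmod p) (prod_op p)"
      using affine_shift_isomorphic_imp_eq[OF p0, of 0 t] affine_shift_not_isomorphic_prod[OF p1] p0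
      unfolding zero_twist t(2) twist by auto
  qed
  show "\<forall>f\<in>linear_maps p. \<forall>g\<in>linear_maps p. f \<noteq> g \<longrightarrow>
       \<not> cycle_set_isomorphic (Zmod (p\<^sup>2)) (twisted_shift_op p f) (Zmod (p\<^sup>2)) (twisted_shift_op p g)"
  proof (intro ballI impI notI)
    fix f g assume fg: "f \<in> linear_maps p" "g \<in> linear_maps p" "f \<noteq> g"
      and iso: "cycle_set_isomorphic (Zmod (p\<^sup>2)) (twisted_shift_op p f)
          (Zmod (p\<^sup>2)) (twisted_shift_op p g)"
    obtain s t where st: "s \<in> {1..<int p}" "f = linear_map p s" "t \<in> {1..<int p}" "g = linear_map p t"
      using fg(1,2) unfolding linear_maps_eq_image by blast
    then have "s = t"
      using affine_shift_isomorphic_imp_eq[OF p0, of s t] iso unfolding st(2,4) twist by simp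
    then show False using fg(3) st by simp
  qed
  assume pq: "p = q"
  have pq2: "p * q = p\<^sup>2" by (simp add: pq power2_eq_square)
  show "indecomposable_abelian (p * q) (Zmod (p\<^sup>2)) (shift_op (p\<^sup>2))"
    "permutation_group (Zmod (p\<^sup>2)) (shift_op (p\<^sup>2)) \<cong> integer_mod_group (p\<^sup>2)"
    using affine_shift_properties[OF pp0 twist_dvd] unfolding pq2 zero_twist by blast+
  show "indecomposable_abelian (p * q) (Zmod p \<times> Zmod p) (prod_op p)"
    "permutation_group (Zmod p \<times> Zmod p) (prod_op p) \<cong> integer_mod_group p \<times>\<times> integer_mod_group p"
    using prod_op_properties[OF p1] unfolding pq by blast+
  show "\<forall>f\<in>linear_maps p.
       indecomposable_abelian (p * q) (Zmod (p\<^sup>2)) (twisted_shift_op p f) \<and>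
       permutation_group (Zmod (p\<^sup>2)) (twisted_shift_op p f) \<cong> integer_mod_group (p\<^sup>2)"
    unfolding linear_maps_eq_image pq2
    using affine_shift_properties[OF pp0 twist_dvd] by (auto simp only: twist)
  show "\<forall>(S :: 'a set) opr. indecomposable_abelian (p * q) S opr \<longrightarrow>
       cycle_set_isomorphic S opr (Zmod (p\<^sup>2)) (shift_op (p\<^sup>2)) \<or>
       (\<exists>f\<in>linear_maps p. cycle_set_isomorphic S opr (Zmod (p\<^sup>2)) (twisted_shift_op p f)) \<or>
       cycle_set_isomorphic S opr (Zmod p \<times> Zmod p) (prod_op p)"
    using indecomposable_abelian_prime_prod_cases[OF assms] unfolding pq2 by blast
qed

end
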